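(* Let $\Gamma$ be a finite simplicial graph without triangles, with vertex set $\Gamma^{(0)}$. Then the right-angled Artin group $(A_\Gamma,\Gamma^{(0)})$ is of type $\mathsf{R}$. More precisely, for every real number $r\ge 2$, the Rips complex $R_r(A_\Gamma,\Gamma^{(0)})$ is contractible.
   Context: For a metric space $X$ and a real number $r\ge 0$, the Rips complex $R_r(X)$ is the simplicial complex whose simplices are the non-empty finite subsets of $X$ of diameter $\le r$. A marked group is a pair $(G,S)$, where $G$ is a finitely generated group and $S$ is a finite generating set of $G$. The group $G$ is equipped with the word metric $d_S$: $d_S(g,g)=0$ and, for $g\neq h$, $d_S(g,h)$ is the least $k\in\mathbb{N}$ such that $g^{-1}h=s_1\cdots s_k$ for some $s_1,\ldots,s_k\in S\cup S^{-1}$. Write $R_r(G,S)$ for the Rips complex $R_r(G,d_S)$. A marked group $(G,S)$ is of type $\mathsf{R}$ if there exists a real number $r_0\ge 0$ such that for all real $r\ge r_0$ the Rips complex $R_r(G,S)$ is contractible. For a finite simplicial graph $\Gamma$ (no loops or multiple edges), the right-angled Artin group $A_\Gamma$ is the group generated by the vertices $\Gamma^{(0)}$ of $\Gamma$ subject to the relations that two generators commute if the corresponding vertices span an edge in $\Gamma$. "Without triangles" means that no three vertices of $\Gamma$ are pairwise adjacent. *)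

theory Defs
  imports "HOL-Analysis.Analysis" "HOL-Algebra.Generated_Groups" "Graph_Theory.Pair_Digraph"
begin

section \<open>Simplicial complexes and their geometric realization\<close>

text \<open>
  An abstract simplicial complex is given by its set of (non-empty, finite) simplices. Points of
  the realization are written in barycentric coordinates.
\<close>

definition geometric_simplex :: "'a set \<Rightarrow> ('a \<Rightarrow> real) set" where
  "geometric_simplex \<sigma> = {t. (\<forall>v. 0 \<le> t v) \<and> (\<forall>v. v \<notin> \<sigma> \<longrightarrow> t v = 0) \<and> sum t \<sigma> = 1}"

text \<open>
  The realization carries the weak topology: a set is open iff its trace on every simplex is open
  in the Euclidean topology of that simplex. For finite \<open>\<sigma>\<close> the latter is the topology
  induced by the product topology on functions, since all coordinates outside \<open>\<sigma>\<close> vanish.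
\<close>

definition realization :: "'a set set \<Rightarrow> ('a \<Rightarrow> real) topology" where
  "realization K = topology (\<lambda>U. U \<subseteq> (\<Union>\<sigma>\<in>K. geometric_simplex \<sigma>) \<and>
     (\<forall>\<sigma>\<in>K. openin (subtopology (powertop_real UNIV) (geometric_simplex \<sigma>))
               (U \<inter> geometric_simplex \<sigma>)))"

lemma openin_realization:
  "openin (realization K) U \<longleftrightarrow>
     U \<subseteq> (\<Union>\<sigma>\<in>K. geometric_simplex \<sigma>) \<and>
     (\<forall>\<sigma>\<in>K. openin (subtopology (powertop_real UNIV) (geometric_simplex \<sigma>))
               (U \<inter> geometric_simplex \<sigma>))"
proof -
  have "istopology (\<lambda>U. U \<subseteq> (\<Union>\<sigma>\<in>K. geometric_simplex \<sigma>) \<and>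
     (\<forall>\<sigma>\<in>K. openin (subtopology (powertop_real UNIV) (geometric_simplex \<sigma>))
               (U \<inter> geometric_simplex \<sigma>)))" (is "istopology ?P")
    unfolding istopology_def
  proof (rule conjI; intro allI impI)
    fix S T assume "?P S" "?P T"
    moreover have "(S \<inter> T) \<inter> A = (S \<inter> A) \<inter> (T \<inter> A)" for A by blast
    ultimately show "?P (S \<inter> T)" by (auto intro: openin_Int)
  next
    fix \<K> assume *: "\<forall>S\<in>\<K>. ?P S"
    show "?P (\<Union>\<K>)"
    proof (intro conjI ballI)
      fix \<sigma> assume "\<sigma> \<in> K"
      with * have "openin (subtopology (powertop_real UNIV) (geometric_simplex \<sigma>))
          (\<Union>S\<in>\<K>. S \<inter> geometric_simplex \<sigma>)"
        by (intro openin_Union) auto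
      moreover have "(\<Union>S\<in>\<K>. S \<inter> geometric_simplex \<sigma>) = \<Union>\<K> \<inter> geometric_simplex \<sigma>" by blast
      ultimately show "openin (subtopology (powertop_real UNIV) (geometric_simplex \<sigma>))
          (\<Union>\<K> \<inter> geometric_simplex \<sigma>)"
        by (simp only:)
    qed (use * in blast)
  qed
  then show ?thesis by (simp add: realization_def topology_inverse')
qed

lemma topspace_realization: "topspace (realization K) = (\<Union>\<sigma>\<in>K. geometric_simplex \<sigma>)"
proof -
  have "openin (realization K) (\<Union>\<sigma>\<in>K. geometric_simplex \<sigma>)"
    unfolding openin_realization
  proof (intro conjI ballI)
    fix \<tau> assume "\<tau> \<in> K"
    then have "(\<Union>\<sigma>\<in>K. geometric_simplex \<sigma>) \<inter> geometric_simplex \<tau> = geometric_simplex \<tau>" by blast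
    then show "openin (subtopology (powertop_real UNIV) (geometric_simplex \<tau>))
        ((\<Union>\<sigma>\<in>K. geometric_simplex \<sigma>) \<inter> geometric_simplex \<tau>)"
      by (simp add: openin_subtopology_refl PiE_UNIV_domain)
  qed simp
  then show ?thesis
    by (metis openin_realization openin_subset openin_topspace subset_antisym)
qed

section \<open>Rips complexes\<close>

text \<open>The analogue of \<^const>\<open>diameter\<close> for an explicitly given metric.\<close>

definition metric_diameter :: "('a \<Rightarrow> 'a \<Rightarrow> real) \<Rightarrow> 'a set \<Rightarrow> real" where
  "metric_diameter d S = (if S = {} then 0 else SUP (x, y)\<in>S \<times> S. d x y)"

definition rips_complex :: "'a set \<Rightarrow> ('a \<Rightarrow> 'a \<Rightarrow> real) \<Rightarrow> real \<Rightarrow> 'a set set" where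
  "rips_complex X d r = {\<sigma>. \<sigma> \<noteq> {} \<and> finite \<sigma> \<and> \<sigma> \<subseteq> X \<and> metric_diameter d \<sigma> \<le> r}"

lemma rips_complex_iff:
  "\<sigma> \<in> rips_complex X d r \<longleftrightarrow>
     \<sigma> \<noteq> {} \<and> finite \<sigma> \<and> \<sigma> \<subseteq> X \<and> (\<forall>x\<in>\<sigma>. \<forall>y\<in>\<sigma>. d x y \<le> r)"
proof -
  have "metric_diameter d \<sigma> \<le> r \<longleftrightarrow> (\<forall>x\<in>\<sigma>. \<forall>y\<in>\<sigma>. d x y \<le> r)" if "\<sigma> \<noteq> {}" "finite \<sigma>"
    using that by (simp add: metric_diameter_def cSUP_le_iff bdd_above_finite)
  then show ?thesis by (auto simp: rips_complex_def)
qed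

section \<open>Marked groups\<close>

definition marked_group :: "('a, 'b) monoid_scheme \<Rightarrow> 'a set \<Rightarrow> bool" where
  "marked_group G S \<longleftrightarrow> group G \<and> finite S \<and> S \<subseteq> carrier G \<and> generate G S = carrier G"

definition word_metric :: "('a, 'b) monoid_scheme \<Rightarrow> 'a set \<Rightarrow> 'a \<Rightarrow> 'a \<Rightarrow> real" where
  "word_metric G S g h =
     (if g = h then 0
      else real (LEAST k. \<exists>s. length s = k \<and> set s \<subseteq> S \<union> set_inv\<^bsub>G\<^esub> S \<and>
                   inv\<^bsub>G\<^esub> g \<otimes>\<^bsub>G\<^esub> h = foldr (\<otimes>\<^bsub>G\<^esub>) s \<one>\<^bsub>G\<^esub>))"

definition rips_group :: "('a, 'b) monoid_scheme \<Rightarrow> 'a set \<Rightarrow> real \<Rightarrow> 'a set set" where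
  "rips_group G S r = rips_complex (carrier G) (word_metric G S) r"

definition type_R :: "('a, 'b) monoid_scheme \<Rightarrow> 'a set \<Rightarrow> bool" where
  "type_R G S \<longleftrightarrow> marked_group G S \<and>
     (\<exists>r0\<ge>0. \<forall>r\<ge>r0. contractible_space (realization (rips_group G S r)))"

section \<open>Groups given by generators and relations\<close>

text \<open>
  A letter \<open>(x, True)\<close> stands for the generator \<open>x\<close> and \<open>(x, False)\<close> for its formal inverse; a pair
  \<open>(u, v)\<close> of words in \<open>R\<close> stands for the relation \<open>u = v\<close>. The group with
  generators \<open>X\<close> and relations \<open>R\<close> is the quotient of the monoid of words by the smallest
  congruence that contains \<open>R\<close> and cancels adjacent mutually inverse letters.
\<close>

type_synonym 'a gword = "('a \<times> bool) list"

definition gwords :: "'a set \<Rightarrow> 'a gword set" where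
  "gwords X = lists (X \<times> UNIV)"

inductive pres_cong :: "'a set \<Rightarrow> ('a gword \<times> 'a gword) set \<Rightarrow> 'a gword \<Rightarrow> 'a gword \<Rightarrow> bool"
  for X R where
  refl: "w \<in> gwords X \<Longrightarrow> pres_cong X R w w"
| sym: "pres_cong X R u v \<Longrightarrow> pres_cong X R v u"
| trans: "pres_cong X R u v \<Longrightarrow> pres_cong X R v w \<Longrightarrow> pres_cong X R u w"
| append: "pres_cong X R u u' \<Longrightarrow> pres_cong X R v v' \<Longrightarrow> pres_cong X R (u @ v) (u' @ v')"
| cancel: "x \<in> X \<Longrightarrow> pres_cong X R [(x, b), (x, \<not> b)] []"
| rel: "(u, v) \<in> R \<Longrightarrow> u \<in> gwords X \<Longrightarrow> v \<in> gwords X \<Longrightarrow> pres_cong X R u v"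

definition pres_class ::
    "'a set \<Rightarrow> ('a gword \<times> 'a gword) set \<Rightarrow> 'a gword \<Rightarrow> 'a gword set" where
  "pres_class X R w = {v. pres_cong X R w v}"

definition presented_group ::
    "'a set \<Rightarrow> ('a gword \<times> 'a gword) set \<Rightarrow> 'a gword set monoid" where
  "presented_group X R =
     \<lparr>carrier = pres_class X R ` gwords X,
      monoid.mult = (\<lambda>A B. \<Union>u\<in>A. \<Union>v\<in>B. pres_class X R (u @ v)),
      one = pres_class X R []\<rparr>"

lemma pres_cong_words:
  assumes "pres_cong X R u v" shows "u \<in> gwords X \<and> v \<in> gwords X"
  using assms by induction (auto simp: gwords_def)

lemma pres_class_eq_iff:
  assumes "u \<in> gwords X"
  shows "pres_class X R u = pres_class X R v \<longleftrightarrow> pres_cong X R u v"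
  using assms unfolding pres_class_def
  by (auto intro: pres_cong.refl pres_cong.sym pres_cong.trans)

lemma presented_group_mult:
  assumes "u \<in> gwords X" "v \<in> gwords X"
  shows "pres_class X R u \<otimes>\<^bsub>presented_group X R\<^esub> pres_class X R v = pres_class X R (u @ v)"
proof -
  have "pres_class X R (u' @ v') = pres_class X R (u @ v)"
    if "pres_cong X R u u'" "pres_cong X R v v'" for u' v'
    using that
    by (metis pres_class_eq_iff pres_cong.append pres_cong_words)
  then have "\<And>u' v'. u' \<in> pres_class X R u \<Longrightarrow> v' \<in> pres_class X R v \<Longrightarrow>
      pres_class X R (u' @ v') = pres_class X R (u @ v)"
    by (simp add: pres_class_def)
  moreover have "u \<in> pres_class X R u" "v \<in> pres_class X R v"
    using assms by (auto simp: pres_class_def intro: pres_cong.refl)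
  ultimately have "(\<Union>u'\<in>pres_class X R u. \<Union>v'\<in>pres_class X R v. pres_class X R (u' @ v'))
      = pres_class X R (u @ v)"
    by blast
  then show ?thesis
    by (simp add: presented_group_def)
qed

lemma gwords_append [simp]: "u @ v \<in> gwords X \<longleftrightarrow> u \<in> gwords X \<and> v \<in> gwords X"
  by (auto simp: gwords_def)

lemma gwords_Nil [simp]: "[] \<in> gwords X"
  by (simp add: gwords_def)

lemma pres_cong_inverse:
  "w \<in> gwords X \<Longrightarrow> pres_cong X R (rev (map (\<lambda>(x, b). (x, \<not> b)) w) @ w) []"
proof (induction w)
  case Nil
  then show ?case by (auto intro: pres_cong.refl)
next
  case (Cons a w)
  obtain x b where a: "a = (x, b)" by force
  let ?w' = "rev (map (\<lambda>(x, b). (x, \<not> b)) w)"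
  have x: "x \<in> X" and w: "w \<in> gwords X" using Cons.prems a by (auto simp: gwords_def)
  have w': "?w' \<in> gwords X" using w by (auto simp: gwords_def)
  have "pres_cong X R ([(x, \<not> b), (x, b)] @ w) ([] @ w)"
    using pres_cong.cancel[OF x, of R "\<not> b"] pres_cong.refl[OF w] by (intro pres_cong.append) auto
  then have "pres_cong X R (?w' @ ([(x, \<not> b), (x, b)] @ w)) (?w' @ ([] @ w))"
    by (rule pres_cong.append[OF pres_cong.refl[OF w']])
  then show ?case using Cons.IH[OF w] a by (auto intro: pres_cong.trans)
qed

lemma group_presented_group: "group (presented_group X R)"
proof (rule groupI)
  note * = presented_group_mult
  have c: "carrier (presented_group X R) = pres_class X R ` gwords X"
    and o: "\<one>\<^bsub>presented_group X R\<^esub> = pres_class X R []"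
    by (simp_all add: presented_group_def)
  show "A \<otimes>\<^bsub>presented_group X R\<^esub> B \<in> carrier (presented_group X R)"
    if "A \<in> carrier (presented_group X R)" "B \<in> carrier (presented_group X R)" for A B
    using that by (auto simp: c *)
  show "\<one>\<^bsub>presented_group X R\<^esub> \<in> carrier (presented_group X R)"
    by (simp add: c o)
  show "A \<otimes>\<^bsub>presented_group X R\<^esub> B \<otimes>\<^bsub>presented_group X R\<^esub> C =
        A \<otimes>\<^bsub>presented_group X R\<^esub> (B \<otimes>\<^bsub>presented_group X R\<^esub> C)"
    if "A \<in> carrier (presented_group X R)" "B \<in> carrier (presented_group X R)"
      "C \<in> carrier (presented_group X R)" for A B C
    using that by (auto simp: c *)
  show "\<one>\<^bsub>presented_group X R\<^esub> \<otimes>\<^bsub>presented_group X R\<^esub> A = A"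
    if "A \<in> carrier (presented_group X R)" for A
    using that by (auto simp: c o *)
  show "\<exists>B\<in>carrier (presented_group X R). B \<otimes>\<^bsub>presented_group X R\<^esub> A = \<one>\<^bsub>presented_group X R\<^esub>"
    if A: "A \<in> carrier (presented_group X R)" for A
  proof -
    obtain w where w: "w \<in> gwords X" "A = pres_class X R w" using A unfolding c by blast
    let ?w' = "rev (map (\<lambda>(x, b). (x, \<not> b)) w)"
    have w': "?w' \<in> gwords X" using w by (auto simp: gwords_def)
    have "pres_class X R (?w' @ w) = pres_class X R []"
      using pres_cong_inverse[OF w(1)] w w' by (subst pres_class_eq_iff) auto
    then show ?thesis using w w' by (auto simp: c o * intro!: bexI[of _ "pres_class X R ?w'"])
  qed
qed

section \<open>Right-angled Artin groups\<close>

text \<open>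
  A finite simplicial graph is a finite symmetric loop-free digraph whose arcs are ordered pairs of
  vertices, so that an edge is a pair of opposite arcs.
\<close>

definition raag_relations :: "'v pair_pre_digraph \<Rightarrow> ('v gword \<times> 'v gword) set" where
  "raag_relations \<Gamma> =
     {([(x, True), (y, True)], [(y, True), (x, True)]) | x y. (x, y) \<in> parcs \<Gamma>}"

definition raag :: "'v pair_pre_digraph \<Rightarrow> 'v gword set monoid" where
  "raag \<Gamma> = presented_group (pverts \<Gamma>) (raag_relations \<Gamma>)"

definition raag_generators :: "'v pair_pre_digraph \<Rightarrow> 'v gword set set" where
  "raag_generators \<Gamma> =
     (\<lambda>x. pres_class (pverts \<Gamma>) (raag_relations \<Gamma>) [(x, True)]) ` pverts \<Gamma>"

lemma marked_group_raag:
  assumes "pair_graph \<Gamma>" shows "marked_group (raag \<Gamma>) (raag_generators \<Gamma>)"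
proof -
  let ?X = "pverts \<Gamma>" and ?R = "raag_relations \<Gamma>"
  let ?G = "presented_group ?X ?R" and ?S = "raag_generators \<Gamma>" and ?c = "pres_class ?X ?R"
  interpret G: group ?G by (rule group_presented_group)
  have c: "carrier ?G = ?c ` gwords ?X" and o: "\<one>\<^bsub>?G\<^esub> = ?c []"
    by (simp_all add: presented_group_def)
  have fin: "finite ?S"
    using assms by (simp add: raag_generators_def pair_graph_def pair_digraph_def
        pair_fin_digraph_def pair_fin_digraph_axioms_def)
  have sub: "?S \<subseteq> carrier ?G" unfolding c raag_generators_def gwords_def by auto
  have letter: "?c [(x, b)] \<in> generate ?G ?S" if "x \<in> ?X" for x b
  proof (cases b)
    case True
    then show ?thesis using that by (auto simp: raag_generators_def intro: generate.incl)
  next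
    case False
    have w: "[(x, b)] \<in> gwords ?X" for b using that by (simp add: gwords_def)
    have "?c [(x, False)] \<otimes>\<^bsub>?G\<^esub> ?c [(x, True)] = \<one>\<^bsub>?G\<^esub>"
      using pres_cong.cancel[OF that, of ?R False] w
      by (simp add: presented_group_mult o pres_class_eq_iff gwords_def)
    then have "inv\<^bsub>?G\<^esub> (?c [(x, True)]) = ?c [(x, False)]"
      using w by (intro G.inv_equality) (auto simp: c)
    moreover have "inv\<^bsub>?G\<^esub> (?c [(x, True)]) \<in> generate ?G ?S"
      using that by (intro generate.inv) (auto simp: raag_generators_def)
    ultimately show ?thesis using False by simp
  qed
  have "?c w \<in> generate ?G ?S" if "w \<in> gwords ?X" for w
    using that
  proof (induction w)
    case Nil
    then show ?case using generate.one[of ?G ?S] by (simp add: o)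
  next
    case (Cons a w)
    obtain x b where a: "a = (x, b)" by force
    have x: "x \<in> ?X" and w: "w \<in> gwords ?X" and l: "[a] \<in> gwords ?X"
      using Cons.prems a by (auto simp: gwords_def)
    have "?c [a] \<otimes>\<^bsub>?G\<^esub> ?c w \<in> generate ?G ?S"
      using letter[OF x, of b] Cons.IH[OF w] a by (auto intro: generate.eng)
    then show ?case using presented_group_mult[OF l w, of ?R] by simp
  qed
  then have "generate ?G ?S = carrier ?G"
    using G.generate_incl[OF sub] by (auto simp: c)
  then show ?thesis
    using fin sub group_presented_group by (simp add: marked_group_def raag_def)
qed

definition triangle_free :: "'v pair_pre_digraph \<Rightarrow> bool" where
  "triangle_free \<Gamma> \<longleftrightarrow>
     \<not> (\<exists>x y z. (x, y) \<in> parcs \<Gamma> \<and> (y, z) \<in> parcs \<Gamma> \<and> (x, z) \<in> parcs \<Gamma>)"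

end

theory Submission
  imports Defs
begin

text \<open>
  Let \<open>g \<noteq> 1\<close> and let \<open>u \<noteq> g\<close> be no longer than \<open>g\<close>. Some letter \<open>t\<close> shortens \<open>g\<close> and at the same
  time brings it closer to \<open>u\<close>. The letters that shorten \<open>g\<close> commute pairwise and belong to distinct
  vertices, so without triangles there are at most two of them. Multiplying \<open>g\<close> by all of them gives a
  shorter element \<open>g'\<close> with \<open>d(g, g') \<le> 2\<close> and \<open>d(u, g') \<le> d(u, g)\<close> for all such \<open>u\<close>. Hence the
  elements of maximal length of a simplex can be replaced by shorter ones within a common simplex, and
  pushing down one length after the other contracts the whole complex to the vertex \<open>1\<close>.
\<close>

section \<open>Continuity on realizations\<close>

text \<open>The letter \<open>t\<close> depends on \<open>u\<close>, whereas \<open>g'\<close> has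
  to serve all \<open>u\<close> at once; this is why all shortening letters of \<open>g\<close> are
  applied together. One of them lowers the distance to \<open>u\<close> by one and every other may
  raise it by one, so the estimate closes for two letters and would not for three. The bound
  \<open>d(g, g') \<le> 2\<close> covers the remaining point \<open>u = g\<close> and is the source
  of \<open>r \<ge> 2\<close>.

  The common letter is found by stripping cancelling letters from the product of the inverse of
  \<open>u\<close> with \<open>g\<close>: the product stays the same, and the first factor stays no
  longer than the second.

  There may be infinitely many levels, so the contraction is one explicit formula, run from the
  constant map at time 0 to the identity at time 1. Each simplex meets only finitely many levels,
  which is what continuity in the weak topology asks for.

  A presentation yields upper bounds on lengths but no lower ones. Pilings, on which words act,
  supply the invariant from which lengths and shortening letters are read off.\<close>

lemma closedin_realization:
  "closedin (realization K) C \<longleftrightarrow> C \<subseteq> (\<Union>\<sigma>\<in>K. geometric_simplex \<sigma>) \<and>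
     (\<forall>\<sigma>\<in>K. closedin (subtopology (powertop_real UNIV) (geometric_simplex \<sigma>))
               (C \<inter> geometric_simplex \<sigma>))"
proof -
  have eq: "((\<Union>\<sigma>\<in>K. geometric_simplex \<sigma>) - C) \<inter> geometric_simplex \<sigma>
      = geometric_simplex \<sigma> - C \<inter> geometric_simplex \<sigma>" if "\<sigma> \<in> K" for \<sigma>
    using that by blast
  show ?thesis
    unfolding closedin_def topspace_realization openin_realization
    by (auto simp: eq)
qed

text \<open>Closedness in the whole product turns sets closed in a simplex into sets closed in the
  product, which can then be pulled back along maps into the product.\<close>

lemma closedin_geometric_simplex:
  assumes "finite \<sigma>"
  shows "closedin (powertop_real UNIV) (geometric_simplex \<sigma>)"
proof -
  have proj: "continuous_map (powertop_real UNIV) euclideanreal (\<lambda>t. t v)" for v :: 'a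
    by (rule continuous_map_product_projection) simp
  have pos: "closedin (powertop_real UNIV) {t :: 'a \<Rightarrow> real. 0 \<le> t v}" for v
    using closedin_continuous_map_preimage[OF proj, of "{0..}" v] by simp
  have zero: "closedin (powertop_real UNIV) {t :: 'a \<Rightarrow> real. t v = 0}" for v
    using closedin_continuous_map_preimage[OF proj, of "{0}" v] by simp
  have "continuous_map (powertop_real UNIV) euclideanreal (\<lambda>t. sum t \<sigma>)"
    using assms proj by (intro continuous_map_sum) auto
  then have one: "closedin (powertop_real UNIV) {t :: 'a \<Rightarrow> real. sum t \<sigma> = 1}"
    using closedin_continuous_map_preimage[of "powertop_real UNIV" euclideanreal "\<lambda>t. sum t \<sigma>" "{1}"] by simp
  have "geometric_simplex \<sigma> = (\<Inter>v. {t. 0 \<le> t v}) \<inter> (\<Inter>v. if v \<in> \<sigma> then UNIV else {t. t v = 0}) \<inter> {t. sum t \<sigma> = 1}"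
    by (auto simp: geometric_simplex_def split: if_splits)
  also have "closedin (powertop_real UNIV) \<dots>"
  proof (intro closedin_Int closedin_INT one)
    show "closedin (powertop_real UNIV) (if v \<in> \<sigma> then UNIV else {t :: 'a \<Rightarrow> real. t v = 0})" for v
      using zero closedin_topspace[of "powertop_real (UNIV :: 'a set)"] by (simp add: PiE_UNIV_domain)
  qed (use pos in auto)
  finally show ?thesis .
qed

text \<open>The interval being compact, a neighbourhood of \<open>t\<close> can be tested on each simplex separately.\<close>

lemma continuous_map_interval_times_realization:
  assumes cont: "\<And>\<sigma>. \<sigma> \<in> K \<Longrightarrow> continuous_map (prod_topology (top_of_set {0..1::real})
      (subtopology (powertop_real UNIV) (geometric_simplex \<sigma>))) Y h"
  shows "continuous_map (prod_topology (top_of_set {0..1}) (realization K)) Y h"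
  unfolding continuous_map_def
proof (intro conjI allI impI)
  let ?I = "top_of_set {0..1::real}"
  let ?S = "\<lambda>\<sigma>. subtopology (powertop_real UNIV) (geometric_simplex \<sigma>)"
  have topS: "topspace (?S \<sigma>) = geometric_simplex \<sigma>" for \<sigma> :: "'a set"
    by (simp add: PiE_UNIV_domain)
  show maps: "h \<in> topspace (prod_topology ?I (realization K)) \<rightarrow> topspace Y"
    using cont by (fastforce simp: continuous_map_def topspace_realization Pi_iff topS)
  fix W assume W: "openin Y W"
  let ?V = "{x \<in> topspace (prod_topology ?I (realization K)). h x \<in> W}"
  have V\<sigma>: "openin (prod_topology ?I (?S \<sigma>)) {x \<in> {0..1} \<times> geometric_simplex \<sigma>. h x \<in> W}"
    if "\<sigma> \<in> K" for \<sigma>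
    using openin_continuous_map_preimage[OF cont[OF that] W] by (simp add: PiE_UNIV_domain)
  show "openin (prod_topology ?I (realization K)) ?V"
    unfolding openin_prod_topology_alt
  proof (intro allI impI)
    fix \<tau> t assume "(\<tau>, t) \<in> ?V"
    then obtain \<sigma> where \<sigma>: "\<sigma> \<in> K" "t \<in> geometric_simplex \<sigma>" and \<tau>: "\<tau> \<in> {0..1}" and hW: "h (\<tau>, t) \<in> W"
      by (auto simp: topspace_realization)
    have "continuous_map ?I (prod_topology ?I (?S \<sigma>)) (\<lambda>\<tau>. (\<tau>, t))"
      using \<sigma> by (intro continuous_map_pairedI) (auto simp: PiE_UNIV_domain)
    then have "openin ?I {\<tau> \<in> topspace ?I. (\<tau>, t) \<in> {x \<in> {0..1} \<times> geometric_simplex \<sigma>. h x \<in> W}}"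
      using V\<sigma>[OF \<sigma>(1)] by (rule openin_continuous_map_preimage)
    then have "openin ?I {\<tau> \<in> {0..1}. h (\<tau>, t) \<in> W}"
      using \<sigma> by (auto elim!: back_subst[of "openin ?I"])
    then obtain e where e: "e > 0" "\<And>s. s \<in> {0..1} \<Longrightarrow> dist s \<tau> < e \<Longrightarrow> h (s, t) \<in> W"
      using \<tau> hW unfolding openin_euclidean_subtopology_iff by blast
    \<comment> \<open>Halving the radius gives a compact interval on which \<open>h (s, t)\<close>
      still stays in \<open>W\<close>.\<close>
    define J where "J = {0..1} \<inter> cball \<tau> (e/2)"
    have J: "compactin ?I J" "J \<subseteq> {0..1}" "\<And>s. s \<in> J \<Longrightarrow> h (s, t) \<in> W"
      using e by (auto simp: J_def compactin_subtopology dist_commute intro!: compact_Int)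
    \<comment> \<open>Compactness of \<open>J\<close> enters through the tube lemma, which makes the
      trace of \<open>U\<close> on each simplex open; that is openness in the weak topology.\<close>
    define U where "U = {t \<in> topspace (realization K). \<forall>s\<in>J. h (s, t) \<in> W}"
    have "openin (?S \<rho>) (U \<inter> geometric_simplex \<rho>)" if \<rho>: "\<rho> \<in> K" for \<rho>
    proof (subst openin_subopen, intro ballI)
      fix t' assume t': "t' \<in> U \<inter> geometric_simplex \<rho>"
      have "J \<times> {t'} \<subseteq> {x \<in> {0..1} \<times> geometric_simplex \<rho>. h x \<in> W}"
        using t' J by (auto simp: U_def)
      then obtain A B where AB: "openin ?I A" "openin (?S \<rho>) B" "J \<subseteq> A" "t' \<in> B"
          "A \<times> B \<subseteq> {x \<in> {0..1} \<times> geometric_simplex \<rho>. h x \<in> W}"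
        using tube_lemma_left[OF V\<sigma>[OF \<rho>] J(1), of t'] t' by (auto simp: PiE_UNIV_domain)
      have "B \<subseteq> geometric_simplex \<rho>"
        using openin_subset[OF AB(2)] by simp
      moreover have "B \<subseteq> U"
        using AB(3,5) \<rho> \<open>B \<subseteq> geometric_simplex \<rho>\<close> by (auto simp: U_def topspace_realization)
      ultimately show "\<exists>T. openin (?S \<rho>) T \<and> t' \<in> T \<and> T \<subseteq> U \<inter> geometric_simplex \<rho>"
        using AB by blast
    qed
    then have "openin (realization K) U"
      by (auto simp: openin_realization U_def topspace_realization)
    moreover have "openin ?I ({0..1} \<inter> ball \<tau> (e/2))"
      by (auto simp: openin_open)
    moreover have "t \<in> U"
      using \<sigma> J by (auto simp: U_def topspace_realization)
    moreover have "({0..1} \<inter> ball \<tau> (e/2)) \<times> U \<subseteq> ?V"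
      by (auto simp: U_def J_def)
    ultimately show "\<exists>A B. openin ?I A \<and> openin (realization K) B \<and> \<tau> \<in> A \<and> t \<in> B \<and> A \<times> B \<subseteq> ?V"
      using \<tau> e by (intro exI[of _ "{0..1} \<inter> ball \<tau> (e/2)"] exI[of _ U]) auto
  qed
qed

text \<open>The weak topology may be finer than the product topology, so continuity of the
  coordinates alone does not suffice. If finitely many simplices cover the image, the preimage of a
  closed set is a finite union of preimages of its traces, each closed in the product.\<close>

lemma continuous_map_into_realization:
  assumes cont: "continuous_map X (powertop_real UNIV) f"
    and F: "finite F" "F \<subseteq> K" "\<And>\<sigma>. \<sigma> \<in> F \<Longrightarrow> finite \<sigma>"
    and maps: "\<And>x. x \<in> topspace X \<Longrightarrow> \<exists>\<sigma>\<in>F. f x \<in> geometric_simplex \<sigma>"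
  shows "continuous_map X (realization K) f"
  unfolding continuous_map_closedin
proof (intro conjI allI impI)
  show "f \<in> topspace X \<rightarrow> topspace (realization K)"
    using maps F by (fastforce simp: topspace_realization)
  fix C assume C: "closedin (realization K) C"
  have "closedin X {x \<in> topspace X. f x \<in> C \<inter> geometric_simplex \<sigma>}" if "\<sigma> \<in> F" for \<sigma>
  proof (rule closedin_continuous_map_preimage[OF cont])
    have "\<sigma> \<in> K" "finite \<sigma>" using F that by auto
    then show "closedin (powertop_real UNIV) (C \<inter> geometric_simplex \<sigma>)"
      using C closedin_geometric_simplex closedin_trans_full unfolding closedin_realization by blast
  qed
  then have "closedin X (\<Union>\<sigma>\<in>F. {x \<in> topspace X. f x \<in> C \<inter> geometric_simplex \<sigma>})"
    using F by (intro closedin_Union) auto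
  moreover have "(\<Union>\<sigma>\<in>F. {x \<in> topspace X. f x \<in> C \<inter> geometric_simplex \<sigma>}) = {x \<in> topspace X. f x \<in> C}"
    using maps by blast
  ultimately show "closedin X {x \<in> topspace X. f x \<in> C}" by simp
qed

section \<open>Collapsing a filtered complex level by level\<close>

text \<open>The test \<open>N v \<le> N (p v)\<close> makes the recursion terminate for arbitrary
  \<open>p\<close>; in the locale below, \<open>decreasing\<close> turns every call above level
  \<open>n\<close> into a genuine step down.\<close>

function push_below :: "('a \<Rightarrow> nat) \<Rightarrow> ('a \<Rightarrow> 'a) \<Rightarrow> nat \<Rightarrow> 'a \<Rightarrow> 'a" where
  "push_below N p n v = (if N v \<le> n \<or> N v \<le> N (p v) then v else push_below N p n (p v))"
  by auto
termination by (relation "Wellfounded.measure (\<lambda>(N, p, n, v). N v)") auto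

declare push_below.simps [simp del]

lemma push_below_id: "N v \<le> n \<Longrightarrow> push_below N p n v = v"
  by (subst push_below.simps) simp

text \<open>The time interval in which level \<open>n + 1\<close> is pushed down is \<open>[1 - 2\<^sup>-\<^sup>n, 1 - 2\<^sup>-\<^sup>n\<^sup>-\<^sup>1]\<close>, so that
  there is time for infinitely many levels and no two of them move at once.\<close>

definition level_clock :: "real \<Rightarrow> nat \<Rightarrow> real" where
  "level_clock \<tau> n = max 0 (min 1 (2 ^ Suc n * (\<tau> - 1) + 2))"

text \<open>A telescoping sum weighted by the clocks: with clocks 1, ..., 1, c, 0, 0, ... it
  collapses to a point of the segment between two successive pushes of \<open>v\<close>. The bound
  \<open>N v\<close> loses nothing, as later pushes fix \<open>v\<close>, and a fixed finite sum is
  visibly continuous in \<open>\<tau>\<close>, also at time 1.\<close>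

definition push_path :: "('a \<Rightarrow> nat) \<Rightarrow> ('a \<Rightarrow> 'a) \<Rightarrow> 'a \<Rightarrow> real \<Rightarrow> 'a \<Rightarrow> real" where
  "push_path N p v \<tau> w = of_bool (push_below N p 0 v = w) +
     (\<Sum>n<N v. level_clock \<tau> n *
        (of_bool (push_below N p (Suc n) v = w) - of_bool (push_below N p n v = w)))"

text \<open>Summing over the support of \<open>t\<close> avoids the choice of a simplex, so the
  linear extensions agree on common faces by construction.\<close>

definition push_homotopy :: "('a \<Rightarrow> nat) \<Rightarrow> ('a \<Rightarrow> 'a) \<Rightarrow> real \<times> ('a \<Rightarrow> real) \<Rightarrow> 'a \<Rightarrow> real" where
  "push_homotopy N p = (\<lambda>(\<tau>, t) w. \<Sum>v | t v \<noteq> 0. t v * push_path N p v \<tau> w)"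

section \<open>Clocks and the paths of single vertices\<close>

lemma level_clock_bounds: "0 \<le> level_clock \<tau> n" "level_clock \<tau> n \<le> 1"
  by (auto simp: level_clock_def)

text \<open>Before clamping, consecutive clocks are related by \<open>c \<mapsto> 2 * c - 2\<close>,
  which is negative once \<open>c < 1\<close>.\<close>

lemma level_clock_next:
  assumes "level_clock \<tau> n < 1" shows "level_clock \<tau> (Suc n) = 0"
proof -
  define c :: real where "c = 2 ^ Suc n * (\<tau> - 1) + 2"
  have "2 ^ Suc (Suc n) * (\<tau> - 1) + 2 = 2 * c - 2" by (simp add: c_def)
  moreover have "c < 1" using assms by (simp add: level_clock_def c_def max_def min_def split: if_splits)
  ultimately show ?thesis by (simp add: level_clock_def)
qed

lemma level_clock_cases:
  obtains "\<And>n. level_clock \<tau> n = 1"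
  | n where "\<And>m. m < n \<Longrightarrow> level_clock \<tau> m = 1" "\<And>m. m > n \<Longrightarrow> level_clock \<tau> m = 0"
proof (cases "\<exists>n. level_clock \<tau> n < 1")
  case True
  define n where "n = (LEAST n. level_clock \<tau> n < 1)"
  have n: "level_clock \<tau> n < 1"
    using True unfolding n_def by (rule LeastI_ex)
  have "level_clock \<tau> m = 1" if "m < n" for m
  proof -
    have "\<not> level_clock \<tau> m < 1"
      using that unfolding n_def by (rule not_less_Least)
    then show ?thesis using level_clock_bounds(2)[of \<tau> m] by linarith
  qed
  moreover have "level_clock \<tau> (Suc (n + k)) = 0" for k
  proof (induction k)
    case 0
    show ?case using level_clock_next[OF n] by simp
  next
    case (Suc k)
    then show ?case using level_clock_next[of \<tau> "Suc (n + k)"] by simp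
  qed
  then have "level_clock \<tau> m = 0" if "m > n" for m
    using that less_imp_Suc_add[OF that] by auto
  ultimately show ?thesis by (rule that(2))
next
  case False
  have "level_clock \<tau> n = 1" for n
  proof -
    have "\<not> level_clock \<tau> n < 1" using False by blast
    then show ?thesis using level_clock_bounds(2)[of \<tau> n] by linarith
  qed
  then show ?thesis by (rule that(1))
qed

lemma push_path_eq:
  assumes "\<And>m. m < n \<Longrightarrow> level_clock \<tau> m = 1" "\<And>m. m > n \<Longrightarrow> level_clock \<tau> m = 0"
  shows "push_path N p v \<tau> w =
    (1 - level_clock \<tau> n) * of_bool (push_below N p n v = w) +
    level_clock \<tau> n * of_bool (push_below N p (Suc n) v = w)"
proof -
  define f :: "nat \<Rightarrow> real" where "f k = of_bool (push_below N p k v = w)" for k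
  have stable: "f k = f (N v)" if "k \<ge> N v" for k
    using that by (simp add: f_def push_below_id)
  have tele: "(\<Sum>k<m. f (Suc k) - f k) = f m - f 0" for m
    by (rule sum_lessThan_telescope)
  have "(\<Sum>k<N v. level_clock \<tau> k * (f (Suc k) - f k))
      = f n - f 0 + level_clock \<tau> n * (f (Suc n) - f n)"
  proof (cases "n < N v")
    case True
    then have "(\<Sum>k<N v. level_clock \<tau> k * (f (Suc k) - f k))
        = (\<Sum>k<Suc n. level_clock \<tau> k * (f (Suc k) - f k))"
      by (intro sum.mono_neutral_right) (auto simp: assms(2))
    also have "\<dots> = (\<Sum>k<n. level_clock \<tau> k * (f (Suc k) - f k)) + level_clock \<tau> n * (f (Suc n) - f n)"
      by simp
    also have "(\<Sum>k<n. level_clock \<tau> k * (f (Suc k) - f k)) = (\<Sum>k<n. f (Suc k) - f k)"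
      by (intro sum.cong) (auto simp: assms(1))
    finally show ?thesis using tele by simp
  next
    \<comment> \<open>Now \<open>N v \<le> n\<close>: every clock in the sum is 1, and the pushes to
      \<open>n\<close> and \<open>Suc n\<close> both fix \<open>v\<close>.\<close>
    case False
    have "(\<Sum>k<N v. level_clock \<tau> k * (f (Suc k) - f k)) = (\<Sum>k<N v. f (Suc k) - f k)"
      by (intro sum.cong) (use False assms(1) in auto)
    then show ?thesis using False stable[of n] stable[of "Suc n"] tele by simp
  qed
  then show ?thesis
    unfolding push_path_def by (simp add: f_def algebra_simps)
qed

lemma push_path_final:
  assumes "\<And>n. level_clock \<tau> n = 1"
  shows "push_path N p v \<tau> w = of_bool (v = w)"
proof -
  define f :: "nat \<Rightarrow> real" where "f k = of_bool (push_below N p k v = w)" for k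
  have "(\<Sum>k<N v. f (Suc k) - f k) = f (N v) - f 0"
    by (rule sum_lessThan_telescope)
  moreover have "f (N v) = of_bool (v = w)" by (simp add: f_def push_below_id)
  ultimately show ?thesis by (simp add: push_path_def assms f_def)
qed

lemma push_homotopy_eq:
  assumes "finite \<sigma>" "t \<in> geometric_simplex \<sigma>"
  shows "push_homotopy N p (\<tau>, t) w = (\<Sum>v\<in>\<sigma>. t v * push_path N p v \<tau> w)"
  unfolding push_homotopy_def case_prod_conv
  by (rule sum.mono_neutral_left) (use assms in \<open>auto simp: geometric_simplex_def\<close>)

lemma sum_coordinate:
  assumes "finite \<sigma>" "t \<in> geometric_simplex \<sigma>"
  shows "(\<Sum>v\<in>\<sigma>. t v * of_bool (v = w)) = t w"
proof -
  have "(\<Sum>v\<in>\<sigma>. t v * of_bool (v = w)) = (\<Sum>v\<in>\<sigma>. if v = w then t v else 0)"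
    by (intro sum.cong) auto
  then show ?thesis
    using assms by (simp add: geometric_simplex_def sum.delta)
qed

lemma convex_combination_in_simplex:
  assumes "finite \<sigma>" "t \<in> geometric_simplex \<sigma>" "finite \<rho>"
    and "\<And>v. v \<in> \<sigma> \<Longrightarrow> g v \<in> geometric_simplex \<rho>"
  shows "(\<lambda>w. \<Sum>v\<in>\<sigma>. t v * g v w) \<in> geometric_simplex \<rho>"
proof -
  have "(\<Sum>w\<in>\<rho>. \<Sum>v\<in>\<sigma>. t v * g v w) = (\<Sum>v\<in>\<sigma>. t v * (\<Sum>w\<in>\<rho>. g v w))"
    by (subst sum.swap) (simp add: sum_distrib_left)
  also have "\<dots> = (\<Sum>v\<in>\<sigma>. t v)"
    using assms(4) by (intro sum.cong) (auto simp: geometric_simplex_def)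
  finally show ?thesis
    using assms by (auto simp: geometric_simplex_def intro!: sum_nonneg sum.neutral)
qed

lemma segment_in_simplex:
  assumes "finite \<rho>" "a \<in> \<rho>" "b \<in> \<rho>" "0 \<le> c" "c \<le> 1"
  shows "(\<lambda>w. (1 - c) * of_bool (a = w) + c * of_bool (b = w)) \<in> geometric_simplex \<rho>"
  using assms
  by (auto simp: geometric_simplex_def sum.distrib sum_distrib_left[symmetric] of_bool_def sum.delta)

text \<open>In \<open>collapse\<close> the old vertices are kept next to their parents: a
  straight-line motion needs both ends in one simplex.\<close>

locale collapsing_complex =
  fixes K :: "'a set set" and N :: "'a \<Rightarrow> nat" and p :: "'a \<Rightarrow> 'a" and a :: 'a
  assumes simplices: "\<sigma> \<in> K \<Longrightarrow> finite \<sigma> \<and> \<sigma> \<noteq> {}"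
    and faces: "\<lbrakk>\<sigma> \<in> K; \<tau> \<subseteq> \<sigma>; \<tau> \<noteq> {}\<rbrakk> \<Longrightarrow> \<tau> \<in> K"
    and collapse: "\<lbrakk>\<sigma> \<in> K; \<And>v. v \<in> \<sigma> \<Longrightarrow> N v \<le> Suc n\<rbrakk> \<Longrightarrow> \<sigma> \<union> p ` {v \<in> \<sigma>. N v = Suc n} \<in> K"
    and decreasing: "\<lbrakk>{v} \<in> K; N v > 0\<rbrakk> \<Longrightarrow> N (p v) < N v"
    and root: "{v} \<in> K \<Longrightarrow> N v = 0 \<longleftrightarrow> v = a"
    and base: "{a} \<in> K"
begin

abbreviation "push n \<equiv> push_below N p n"

lemma vertex: "\<lbrakk>\<sigma> \<in> K; v \<in> \<sigma>\<rbrakk> \<Longrightarrow> {v} \<in> K"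
  using faces by blast

lemma parent_vertex:
  assumes "{v} \<in> K" "N v > 0"
  shows "{p v} \<in> K"
proof -
  have "{v} \<union> p ` {u \<in> {v}. N u = Suc (N v - 1)} \<in> K"
    using assms by (intro collapse) auto
  then show ?thesis using assms by (auto intro: vertex)
qed

lemma push_step:
  assumes "{v} \<in> K" "n < N v"
  shows "push n v = push n (p v)"
  using decreasing[of v] assms by (subst push_below.simps) auto

lemma push_level:
  assumes "{v} \<in> K"
  shows "{push n v} \<in> K \<and> N (push n v) \<le> n"
  using assms
proof (induction "N v" arbitrary: v rule: less_induct)
  case less
  show ?case
  proof (cases "N v \<le> n")
    case True
    then show ?thesis using less.prems by (simp add: push_below_id)
  next
    case False
    then have "0 < N v" "n < N v" by auto
    then have "N (p v) < N v" "{p v} \<in> K" "push n v = push n (p v)"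
      using less.prems decreasing parent_vertex push_step by blast+
    then show ?thesis using less.hyps[of "p v"] by metis
  qed
qed

text \<open>Both pushes follow the same chain of parents; the one to \<open>n\<close> makes one
  further step exactly when the other stops at level \<open>Suc n\<close>.\<close>

lemma push_Suc:
  assumes "{v} \<in> K"
  shows "push n v = (if N (push (Suc n) v) = Suc n then p (push (Suc n) v) else push (Suc n) v)"
  using assms
proof (induction "N v" arbitrary: v rule: less_induct)
  case less
  consider "N v \<le> n" | "N v = Suc n" | "Suc n < N v" by linarith
  then show ?case
  proof cases
    case 1
    then show ?thesis by (simp add: push_below_id)
  next
    case 2
    then have "N (p v) < N v" "push n v = push n (p v)"
      using less.prems decreasing[of v] push_step[of v n] by auto
    then show ?thesis using 2 by (simp add: push_below_id)
  next
    case 3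
    then have "N (p v) < N v" "{p v} \<in> K" "push n v = push n (p v)" "push (Suc n) v = push (Suc n) (p v)"
      using less.prems decreasing[of v] parent_vertex[of v] push_step[of v n] push_step[of v "Suc n"]
      by (metis less_trans lessI zero_less_Suc)+
    then show ?thesis using less.hyps[of "p v"] by metis
  qed
qed

text \<open>\<open>collapse\<close> is applied to the simplex already pushed to level
  \<open>Suc n\<close>; by \<open>push_Suc\<close> the parents added there provide all the points
  \<open>push n v\<close>.\<close>

lemma push_image_Un:
  assumes "\<sigma> \<in> K" and K: "push (Suc n) ` \<sigma> \<in> K"
  shows "push (Suc n) ` \<sigma> \<union> push n ` \<sigma> \<in> K"
proof -
  let ?\<rho> = "push (Suc n) ` \<sigma>"
  have v: "{v} \<in> K" if "v \<in> \<sigma>" for v using vertex assms that by blast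
  have "?\<rho> \<union> p ` {v \<in> ?\<rho>. N v = Suc n} \<in> K"
  proof (rule collapse[OF K])
    fix u assume "u \<in> ?\<rho>"
    then obtain v' where "v' \<in> \<sigma>" "u = push (Suc n) v'" by blast
    then show "N u \<le> Suc n" using push_level[OF v, of v' "Suc n"] by simp
  qed
  moreover have "?\<rho> \<union> push n ` \<sigma> \<subseteq> ?\<rho> \<union> p ` {v \<in> ?\<rho>. N v = Suc n}"
  proof -
    have "push n v \<in> ?\<rho> \<union> p ` {v \<in> ?\<rho>. N v = Suc n}" if "v \<in> \<sigma>" for v
    proof (cases "N (push (Suc n) v) = Suc n")
      case True
      have "push n v = p (push (Suc n) v)"
        using push_Suc[OF v[OF that], of n] unfolding if_P[OF True] .
      moreover have "push (Suc n) v \<in> {v \<in> ?\<rho>. N v = Suc n}"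
        using True that by blast
      ultimately show ?thesis by simp
    next
      case False
      have "push n v = push (Suc n) v"
        using push_Suc[OF v[OF that], of n] unfolding if_not_P[OF False] .
      then show ?thesis using that by simp
    qed
    then show ?thesis by blast
  qed
  moreover have "?\<rho> \<union> push n ` \<sigma> \<noteq> {}"
    using simplices assms by auto
  ultimately show "?\<rho> \<union> push n ` \<sigma> \<in> K"
    by (rule faces)
qed

text \<open>Downward induction from the highest level of the simplex, at or above which pushing
  changes nothing.\<close>

lemma push_image:
  assumes "\<sigma> \<in> K"
  shows "push n ` \<sigma> \<in> K"
proof -
  define m where "m = Max (N ` \<sigma>)"
  have m: "N v \<le> m" if "v \<in> \<sigma>" for v
    using simplices[OF assms] that by (simp add: m_def)
  show ?thesis
  proof (cases "n \<le> m")
    case True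
    then show ?thesis
    proof (induction n rule: inc_induct)
      case base
      have "push m ` \<sigma> = \<sigma>" using m by (auto simp: push_below_id image_iff)
      then show ?case using assms by simp
    next
      case (step n)
      show ?case
        by (rule faces[OF push_image_Un[OF assms step.IH]]) (use simplices[OF assms] in auto)
    qed
  next
    case False
    then have "push n ` \<sigma> = \<sigma>" using m by (force simp: push_below_id image_iff)
    then show ?thesis using assms by simp
  qed
qed

text \<open>The bound on \<open>n\<close> is the point: it leaves finitely many target simplices for
  all times, as \<open>continuous_map_into_realization\<close> requires.\<close>

lemma push_homotopy_in_simplex:
  assumes \<sigma>: "\<sigma> \<in> K" and t: "t \<in> geometric_simplex \<sigma>"
  shows "\<exists>n \<le> Max (N ` \<sigma>). push_homotopy N p (\<tau>, t) \<in> geometric_simplex (push (Suc n) ` \<sigma> \<union> push n ` \<sigma>)"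
proof -
  define m where "m = Max (N ` \<sigma>)"
  have fin: "finite \<sigma>" using simplices \<sigma> by blast
  have m: "N v \<le> m" if "v \<in> \<sigma>" for v
    using fin that by (simp add: m_def)
  have H: "push_homotopy N p (\<tau>, t) = (\<lambda>w. \<Sum>v\<in>\<sigma>. t v * push_path N p v \<tau> w)"
    using push_homotopy_eq[OF fin t] by blast
  have big: "push k ` \<sigma> = \<sigma>" if "k \<ge> m" for k
    using m that by (force simp: push_below_id image_iff)
  show ?thesis
  proof (cases rule: level_clock_cases[of \<tau>])
    case 1
    have "push_homotopy N p (\<tau>, t) = t"
    proof
      fix w
      show "push_homotopy N p (\<tau>, t) w = t w"
        unfolding H push_path_final[OF 1] by (rule sum_coordinate[OF fin t])
    qed
    then show ?thesis using t big[of m] big[of "Suc m"] by (auto simp: m_def[symmetric])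
  next
    case (2 n)
    have "push_path N p v \<tau> = (\<lambda>w. (1 - level_clock \<tau> n) * of_bool (push n v = w) +
        level_clock \<tau> n * of_bool (push (Suc n) v = w))" for v
      by (intro ext push_path_eq 2)
    then have "push_path N p v \<tau> \<in> geometric_simplex (push (Suc n) ` \<sigma> \<union> push n ` \<sigma>)" if "v \<in> \<sigma>" for v
      using that fin level_clock_bounds[of \<tau> n] by (auto intro!: segment_in_simplex)
    then have *: "push_homotopy N p (\<tau>, t) \<in> geometric_simplex (push (Suc n) ` \<sigma> \<union> push n ` \<sigma>)"
      unfolding H using fin t by (intro convex_combination_in_simplex) auto
    show ?thesis
    proof (cases "n \<le> m")
      \<comment> \<open>The level now moving lies above the simplex, so all pushes involved are the
        identity on it and \<open>m\<close> may replace \<open>n\<close>.\<close>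
      case False
      then show ?thesis using * big[of n] big[of "Suc n"] big[of m] big[of "Suc m"]
        by (auto simp: m_def[symmetric])
    qed (use * in \<open>auto simp: m_def\<close>)
  qed
qed

lemma continuous_map_push_homotopy:
  "continuous_map (prod_topology (top_of_set {0..1}) (realization K)) (realization K) (push_homotopy N p)"
proof (rule continuous_map_interval_times_realization)
  fix \<sigma> assume \<sigma>: "\<sigma> \<in> K"
  let ?S = "subtopology (powertop_real UNIV) (geometric_simplex \<sigma>)"
  let ?X = "prod_topology (top_of_set {0..1::real}) ?S"
  let ?F = "(\<lambda>n. push (Suc n) ` \<sigma> \<union> push n ` \<sigma>) ` {..Max (N ` \<sigma>)}"
  have fin: "finite \<sigma>" using simplices \<sigma> by blast
  have proj: "continuous_map ?X euclideanreal (\<lambda>x. snd x v)" for v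
  proof -
    have "continuous_map ?S euclideanreal (\<lambda>t. t v)"
      by (intro continuous_map_from_subtopology continuous_map_product_projection) simp
    from continuous_map_compose[OF continuous_map_snd this] show ?thesis by (simp add: o_def)
  qed
  have path: "continuous_map ?X euclideanreal (\<lambda>x. push_path N p v (fst x) w)" for v w
  proof -
    have "continuous_map (top_of_set {0..1}) euclideanreal (\<lambda>\<tau>. push_path N p v \<tau> w)"
      unfolding push_path_def level_clock_def continuous_map_iff_continuous
      by (intro continuous_intros)
    from continuous_map_compose[OF continuous_map_fst this] show ?thesis by (simp add: o_def)
  qed
  have "continuous_map ?X (powertop_real UNIV) (\<lambda>x w. \<Sum>v\<in>\<sigma>. snd x v * push_path N p v (fst x) w)"
    unfolding continuous_map_componentwise_UNIV
    using fin proj path by (intro allI continuous_map_sum continuous_map_real_mult) auto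
  then have "continuous_map ?X (powertop_real UNIV) (push_homotopy N p)"
    by (rule continuous_map_eq) (auto simp: push_homotopy_eq[OF fin] fun_eq_iff)
  then show "continuous_map ?X (realization K) (push_homotopy N p)"
  proof (rule continuous_map_into_realization[where F = ?F])
    show "?F \<subseteq> K" using push_image[OF \<sigma>] push_image_Un[OF \<sigma>] by blast
    show "\<exists>\<rho>\<in>?F. push_homotopy N p x \<in> geometric_simplex \<rho>" if "x \<in> topspace ?X" for x
      using push_homotopy_in_simplex[OF \<sigma>, of "snd x" "fst x"] that by auto
  qed (use fin in auto)
qed

theorem contractible_realization: "contractible_space (realization K)"
proof -
  have start: "push_homotopy N p (0, t) = (\<lambda>w. of_bool (a = w))"
    if t: "t \<in> topspace (realization K)" for t
  proof
    fix w
    obtain \<sigma> where \<sigma>: "\<sigma> \<in> K" "t \<in> geometric_simplex \<sigma>"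
      using t by (auto simp: topspace_realization)
    have "push 0 v = a" if "v \<in> \<sigma>" for v
      using push_level[of v 0] root vertex[OF \<sigma>(1) that] by auto
    moreover have "level_clock 0 n = 0" for n
      unfolding level_clock_def by (intro max_absorb1 min.coboundedI2) simp
    ultimately have "push_path N p v 0 w = of_bool (a = w)" if "v \<in> \<sigma>" for v
      using that by (simp add: push_path_def)
    then have "push_homotopy N p (0, t) w = (\<Sum>v\<in>\<sigma>. t v * of_bool (a = w))"
      using simplices \<sigma> by (simp add: push_homotopy_eq[of \<sigma>])
    also have "\<dots> = of_bool (a = w)"
      using \<sigma>(2) by (cases "a = w") (simp_all add: geometric_simplex_def)
    finally show "push_homotopy N p (0, t) w = of_bool (a = w)" .
  qed
  have final: "push_homotopy N p (1, t) = id t" if t: "t \<in> topspace (realization K)" for t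
  proof
    fix w
    obtain \<sigma> where \<sigma>: "\<sigma> \<in> K" "t \<in> geometric_simplex \<sigma>"
      using t by (auto simp: topspace_realization)
    have "level_clock 1 n = 1" for n
      by (simp add: level_clock_def)
    then have "push_homotopy N p (1, t) w = (\<Sum>v\<in>\<sigma>. t v * of_bool (v = w))"
      using simplices \<sigma> by (simp add: push_homotopy_eq[of \<sigma>] push_path_final)
    also have "\<dots> = t w"
      by (rule sum_coordinate) (use simplices \<sigma> in auto)
    finally show "push_homotopy N p (1, t) w = id t w" by simp
  qed
  have "homotopic_with (\<lambda>x. True) (realization K) (realization K) (\<lambda>x w. of_bool (a = w)) id"
    using continuous_map_push_homotopy start final by (subst homotopic_with) auto
  then show ?thesis
    unfolding contractible_space_def using homotopic_with_symD by blast
qed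

end

section \<open>Groups whose descents commute\<close>

text \<open>These are the only facts about the Artin group that the geometric argument uses.
  Descents act on the right, so they are compatible with the left-invariant word metric;
  \<open>no_three_descents\<close> is what remains of the absence of triangles.\<close>

locale diamond_group = group G for G (structure) +
  fixes L :: "'a set" and len :: "'a \<Rightarrow> nat"
  assumes letters_closed: "L \<subseteq> carrier G"
    and letters_inv: "t \<in> L \<Longrightarrow> inv t \<in> L"
    and len_one: "len \<one> = 0"
    and len_step: "\<lbrakk>g \<in> carrier G; t \<in> L\<rbrakk> \<Longrightarrow> len (g \<otimes> t) = Suc (len g) \<or> len g = Suc (len (g \<otimes> t))"
    and descent_exists: "\<lbrakk>g \<in> carrier G; g \<noteq> \<one>\<rbrakk> \<Longrightarrow> \<exists>t\<in>L. len (g \<otimes> t) < len g"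
    and diamond: "\<lbrakk>g \<in> carrier G; s \<in> L; t \<in> L; s \<noteq> t; len (g \<otimes> s) < len g; len (g \<otimes> t) < len g\<rbrakk>
      \<Longrightarrow> s \<otimes> t = t \<otimes> s \<and> len (g \<otimes> s \<otimes> t) < len (g \<otimes> s)"
    and no_three_descents: "\<lbrakk>g \<in> carrier G; s \<in> L; t \<in> L; u \<in> L; s \<noteq> t; s \<noteq> u; t \<noteq> u;
        len (g \<otimes> s) < len g; len (g \<otimes> t) < len g\<rbrakk> \<Longrightarrow> \<not> len (g \<otimes> u) < len g"
begin

lemma letter_closed [simp, intro]: "t \<in> L \<Longrightarrow> t \<in> carrier G"
  using letters_closed by blast

lemma len_letter_le: "\<lbrakk>g \<in> carrier G; t \<in> L\<rbrakk> \<Longrightarrow> len (g \<otimes> t) \<le> Suc (len g)"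
  using len_step by force

lemma len_eq_0_iff: "g \<in> carrier G \<Longrightarrow> len g = 0 \<longleftrightarrow> g = \<one>"
  using descent_exists len_one by fastforce

text \<open>Undoing a descent writes \<open>g\<close> as a shorter element times a letter, so the
  induction follows a geodesic and appends letters on the right.\<close>

lemma descent_induct [consumes 1, case_names one letter]:
  assumes "g \<in> carrier G" "P \<one>"
    and "\<And>h t. \<lbrakk>h \<in> carrier G; t \<in> L; len (h \<otimes> t) = Suc (len h); P h\<rbrakk> \<Longrightarrow> P (h \<otimes> t)"
  shows "P g"
  using assms(1)
proof (induction "len g" arbitrary: g rule: less_induct)
  case less
  show ?case
  proof (cases "g = \<one>")
    case False
    then obtain t where t: "t \<in> L" "len (g \<otimes> t) < len g"
      using descent_exists less.prems by blast
    let ?h = "g \<otimes> t"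
    have h: "?h \<in> carrier G" "?h \<otimes> inv t = g"
      using less.prems t by (auto simp: m_assoc)
    have "len (?h \<otimes> inv t) = Suc (len ?h)"
      using len_step[of g t] less.prems t h by simp
    then show ?thesis
      using assms(3)[of ?h "inv t"] less.hyps[of ?h] t h letters_inv by auto
  qed (use assms(2) in simp)
qed

lemma len_mult_le:
  assumes "g \<in> carrier G" "h \<in> carrier G"
  shows "len (g \<otimes> h) \<le> len g + len h"
  using assms(2)
proof (induction h rule: descent_induct)
  case one
  then show ?case using assms by (simp add: len_one)
next
  case (letter h t)
  then show ?case
    using len_letter_le[of "g \<otimes> h" t] assms(1) by (simp add: m_assoc)
qed

lemma len_letter: "t \<in> L \<Longrightarrow> len t \<le> 1"
  using len_letter_le[of \<one> t] len_one by simp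

lemma len_letter_mult_le: "\<lbrakk>g \<in> carrier G; t \<in> L\<rbrakk> \<Longrightarrow> len (t \<otimes> g) \<le> Suc (len g)"
  using len_mult_le[of t g] len_letter[of t] by simp

lemma len_inv_le: "g \<in> carrier G \<Longrightarrow> len (inv g) \<le> len g"
proof (induction g rule: descent_induct)
  case one
  then show ?case by simp
next
  case (letter h t)
  then show ?case
    using len_letter_mult_le[of "inv h" "inv t"] letters_inv by (simp add: inv_mult_group)
qed

lemma len_inv: "g \<in> carrier G \<Longrightarrow> len (inv g) = len g"
  using len_inv_le[of g] len_inv_le[of "inv g"] by simp

text \<open>The letter \<open>t\<close> slides leftwards through \<open>b\<close>. If
  \<open>y\<close> is the last letter of \<open>b\<close>, then \<open>inv y\<close> and
  \<open>t\<close> are distinct descents of the product; by \<open>diamond\<close> they commute and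
  \<open>t\<close> is still a descent once \<open>y\<close> has been removed.\<close>

lemma descent_of_product:
  assumes "b \<in> carrier G" "c \<in> carrier G" "t \<in> L" "len (c \<otimes> b) = len c + len b"
    "len (c \<otimes> b \<otimes> t) < len (c \<otimes> b)" "\<not> len (b \<otimes> t) < len b"
  shows "len (c \<otimes> t) < len c \<and> b \<otimes> t = t \<otimes> b"
  using assms(1,4-6)
proof (induction b rule: descent_induct)
  case one
  then show ?case using assms(2,3) by (simp add: len_one)
next
  case (letter b' y)
  let ?y = "inv y" and ?b = "b' \<otimes> y"
  have y: "?y \<in> L" "y \<in> carrier G" "t \<in> carrier G" "?b \<otimes> ?y = b'" "c \<otimes> ?b \<otimes> ?y = c \<otimes> b'"
    using letter assms letters_inv by (auto simp: m_assoc)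
  have "len (c \<otimes> b') \<le> len c + len b'"
    using len_mult_le assms(2) letter.hyps(1) by blast
  then have d: "len (c \<otimes> ?b \<otimes> ?y) < len (c \<otimes> ?b)"
    using letter.hyps(3) letter.prems(1) y by simp
  \<comment> \<open>Otherwise \<open>t\<close> would remove the last letter of \<open>?b\<close>,
    although it does not shorten \<open>?b\<close>.\<close>
  have ne: "?y \<noteq> t"
    using letter.prems(3) letter.hyps(3) y by auto
  have comm: "?y \<otimes> t = t \<otimes> ?y" and d2: "len (c \<otimes> b' \<otimes> t) < len (c \<otimes> b')"
    using diamond[of "c \<otimes> ?b" ?y t] assms(2,3) letter.hyps(1,2) letter.prems(2) y d ne
    by auto
  have comm': "y \<otimes> t = t \<otimes> y"
    by (metis comm inv_comm inv_inv inv_mult_group inv_solve_left inv_solve_right m_closed y(1,2,3) letter_closed m_assoc)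
  have "len (c \<otimes> b') = len c + len b'"
    using len_step[of "c \<otimes> b'" y] letter.hyps letter.prems(1) assms(2) \<open>len (c \<otimes> b') \<le> _\<close>
    by (auto simp: m_assoc)
  moreover have "\<not> len (b' \<otimes> t) < len b'"
  proof
    assume *: "len (b' \<otimes> t) < len b'"
    \<comment> \<open>With \<open>b' \<otimes> t\<close> shorter than \<open>b'\<close>, appending
      \<open>y\<close> would still leave \<open>?b \<otimes> t\<close> shorter than
      \<open>?b\<close>.\<close>
    have "?b \<otimes> t = b' \<otimes> t \<otimes> y"
      using comm' y letter.hyps(1) by (simp add: m_assoc)
    then show False
      using * len_letter_le[of "b' \<otimes> t" y] letter.hyps letter.prems(3) y by simp
  qed
  ultimately have "len (c \<otimes> t) < len c" "b' \<otimes> t = t \<otimes> b'"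
    using letter.IH d2 by auto
  then show ?case
    using comm' y letter.hyps(1) by (metis m_assoc)
qed

text \<open>Either the cancellation already occurs without the last letter \<open>y\<close> of
  \<open>b\<close>, or \<open>y\<close> itself causes it. In the second case
  \<open>descent_of_product\<close> moves \<open>y\<close> to the front of \<open>b\<close>, and
  \<open>x = y\<close> works.\<close>

lemma cancelling_letter:
  assumes "b \<in> carrier G" "c \<in> carrier G" "len (c \<otimes> b) < len c + len b"
  shows "\<exists>x\<in>L. len (c \<otimes> x) < len c \<and> len (inv x \<otimes> b) < len b"
  using assms(1,3)
proof (induction b rule: descent_induct)
  case one
  then show ?case using assms(2) by (simp add: len_one)
next
  case (letter b' y)
  have y: "y \<in> carrier G" using letter by blast
  show ?case
  proof (cases "len (c \<otimes> b') < len c + len b'")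
    case True
    then obtain x where x: "x \<in> L" "len (c \<otimes> x) < len c" "len (inv x \<otimes> b') < len b'"
      using letter.IH by blast
    have "len (inv x \<otimes> (b' \<otimes> y)) \<le> Suc (len (inv x \<otimes> b'))"
      using len_letter_le[of "inv x \<otimes> b'" y] letter.hyps x y by (simp add: m_assoc)
    then show ?thesis using x letter.hyps(3) by auto
  next
    case False
    then have e: "len (c \<otimes> b') = len c + len b'"
      using len_mult_le[of c b'] assms(2) letter.hyps(1) by simp
    have "len (c \<otimes> b' \<otimes> y) < len (c \<otimes> b')"
      using len_step[of "c \<otimes> b'" y] letter.hyps letter.prems assms(2) e by (auto simp: m_assoc)
    then have "len (c \<otimes> y) < len c \<and> b' \<otimes> y = y \<otimes> b'"
      using descent_of_product[of b' c y] letter.hyps assms(2) e by simp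
    moreover have "inv y \<otimes> (y \<otimes> b') = b'"
      using y letter.hyps(1) by (simp add: m_assoc[symmetric])
    ultimately show ?thesis
      using letter.hyps by (intro bexI[of _ y]) auto
  qed
qed

text \<open>Applied with \<open>c = inv u\<close> and \<open>b = g\<close>. While there is
  cancellation, a letter passes from one factor to the other and both become shorter. Without
  cancellation any descent of \<open>b\<close> also shortens the product, whose length is then the
  sum of both lengths.\<close>

lemma common_descent:
  assumes "c \<in> carrier G" "b \<in> carrier G" "len c \<le> len b" "c \<otimes> b \<noteq> \<one>"
  shows "\<exists>t\<in>L. len (b \<otimes> t) < len b \<and> len (c \<otimes> b \<otimes> t) < len (c \<otimes> b)"
  using assms
proof (induction "len c" arbitrary: c b rule: less_induct)
  case less
  show ?case
  proof (cases "len (c \<otimes> b) < len c + len b")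
    case True
    then obtain x where x: "x \<in> L" "len (c \<otimes> x) < len c" "len (inv x \<otimes> b) < len b"
      using cancelling_letter less.prems by blast
    let ?c = "c \<otimes> x" and ?b = "inv x \<otimes> b"
    have xc: "x \<in> carrier G" using x by blast
    have xb: "x \<otimes> ?b = b"
      using less.prems(2) xc by (simp add: m_assoc[of x "inv x" b, symmetric])
    have cb: "?c \<otimes> ?b = c \<otimes> b"
      using less.prems(1,2) xc xb by (simp add: m_assoc)
    have "len b \<le> Suc (len ?b)"
      using len_letter_mult_le[of ?b x] less.prems x xc xb by simp
    \<comment> \<open>\<open>c\<close> loses at least one letter and \<open>b\<close> at most one,
      so the inequality survives for the induction hypothesis.\<close>
    then have "len ?c \<le> len ?b"
      using x(2) less.prems(3) by simp
    then obtain t where t: "t \<in> L" "len (?b \<otimes> t) < len ?b" "len (c \<otimes> b \<otimes> t) < len (c \<otimes> b)"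
      using less.hyps[of ?c ?b] x(2) xc cb less.prems by auto
    have "x \<otimes> (?b \<otimes> t) = b \<otimes> t"
      using less.prems xc t(1) xb by (simp add: m_assoc[symmetric])
    then have "len (b \<otimes> t) \<le> Suc (len (?b \<otimes> t))"
      using len_letter_mult_le[of "?b \<otimes> t" x] less.prems x xc t(1) by simp
    then show ?thesis using t x(3) by (intro bexI[of _ t]) auto
  next
    case False
    have "b \<noteq> \<one>"
    proof
      assume "b = \<one>"
      then have "c = \<one>" using less.prems len_one len_eq_0_iff by simp
      then show False using \<open>b = \<one>\<close> less.prems by simp
    qed
    then obtain t where t: "t \<in> L" "len (b \<otimes> t) < len b"
      using descent_exists less.prems by blast
    have "len (c \<otimes> b \<otimes> t) \<le> len c + len (b \<otimes> t)"
      using len_mult_le[of c "b \<otimes> t"] less.prems t(1) by (simp add: m_assoc)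
    then show ?thesis using t False by (intro bexI[of _ t]) auto
  qed
qed

section \<open>Dominating elements\<close>

abbreviation word_dist :: "'a \<Rightarrow> 'a \<Rightarrow> nat" where
  "word_dist g h \<equiv> len (inv g \<otimes> h)"

lemma word_dist_commute:
  "\<lbrakk>g \<in> carrier G; h \<in> carrier G\<rbrakk> \<Longrightarrow> word_dist g h = word_dist h g"
  using len_inv[of "inv g \<otimes> h"] by (simp add: inv_mult_group)

text \<open>The descent shared with \<open>u\<close> gains one in distance and the other, if
  present, loses at most one. This works in either order because the two descents commute.\<close>

lemma dominating_element:
  assumes g: "g \<in> carrier G" "g \<noteq> \<one>"
  shows "\<exists>g'\<in>carrier G. len g' < len g \<and> word_dist g g' \<le> 2 \<and>
    (\<forall>u\<in>carrier G. len u \<le> len g \<longrightarrow> u \<noteq> g \<longrightarrow> word_dist u g' \<le> word_dist u g)"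
proof -
  have common: "\<exists>t\<in>L. len (g \<otimes> t) < len g \<and> len (inv u \<otimes> (g \<otimes> t)) < len (inv u \<otimes> g)"
    if u: "u \<in> carrier G" "len u \<le> len g" "u \<noteq> g" for u
  proof -
    have "inv u \<otimes> g \<noteq> \<one>"
      using u g by (metis inv_closed inv_equality inv_inv)
    then obtain t where "t \<in> L" "len (g \<otimes> t) < len g" "len (inv u \<otimes> g \<otimes> t) < len (inv u \<otimes> g)"
      using common_descent[of "inv u" g] u g len_inv by auto
    then show ?thesis using u g by (auto simp: m_assoc intro!: bexI[of _ t])
  qed
  obtain s where s: "s \<in> L" "len (g \<otimes> s) < len g"
    using descent_exists g by blast
  have sc: "s \<in> carrier G" using s by blast
  show ?thesis
  proof (cases "\<exists>t\<in>L. t \<noteq> s \<and> len (g \<otimes> t) < len g")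
    case True
    then obtain t where t: "t \<in> L" "t \<noteq> s" "len (g \<otimes> t) < len g" by blast
    have tc: "t \<in> carrier G" using t by blast
    have st: "s \<otimes> t = t \<otimes> s" "len (g \<otimes> s \<otimes> t) < len (g \<otimes> s)"
      using diamond[of g s t] s t g by auto
    let ?g = "g \<otimes> (s \<otimes> t)"
    have "word_dist u ?g \<le> word_dist u g"
      if u: "u \<in> carrier G" "len u \<le> len g" "u \<noteq> g" for u
    proof -
      obtain x where x: "x \<in> L" "len (g \<otimes> x) < len g" "len (inv u \<otimes> (g \<otimes> x)) < len (inv u \<otimes> g)"
        using common[OF u] by blast
      then have "x = s \<or> x = t"
        using no_three_descents[of g s t x] s t g by auto
      then show ?thesis
      proof
        assume "x = s"
        then show ?thesis
          using len_letter_le[of "inv u \<otimes> (g \<otimes> s)" t] x(3) u g t(1) sc tc by (simp add: m_assoc)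
      next
        assume "x = t"
        then show ?thesis
          using len_letter_le[of "inv u \<otimes> (g \<otimes> t)" s] x(3) u g s(1) sc tc st(1) by (simp add: m_assoc)
      qed
    qed
    moreover have "word_dist g ?g \<le> 2"
    proof -
      have "inv g \<otimes> ?g = s \<otimes> t" using g sc tc by (simp add: m_assoc[symmetric])
      then show ?thesis using len_mult_le[of s t] len_letter[of s] len_letter[of t] s t sc tc by simp
    qed
    moreover have "len ?g < len g" using st(2) s(2) g sc tc by (simp add: m_assoc)
    ultimately show ?thesis using g sc tc by (intro bexI[of _ ?g]) auto
  next
    case False
    have "word_dist u (g \<otimes> s) \<le> word_dist u g"
      if u: "u \<in> carrier G" "len u \<le> len g" "u \<noteq> g" for u
      using common[OF u] False by force
    moreover have "word_dist g (g \<otimes> s) \<le> 2"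
      using len_letter[of s] s g sc by (simp add: m_assoc[symmetric])
    ultimately show ?thesis using s g sc by (intro bexI[of _ "g \<otimes> s"]) auto
  qed
qed

section \<open>Comparison with the word metric\<close>

lemma len_foldr_le:
  "set ts \<subseteq> L \<Longrightarrow> foldr (\<otimes>) ts \<one> \<in> carrier G \<and> len (foldr (\<otimes>) ts \<one>) \<le> length ts"
proof (induction ts)
  case (Cons t ts)
  then have "len (t \<otimes> foldr (\<otimes>) ts \<one>) \<le> Suc (len (foldr (\<otimes>) ts \<one>))"
    by (intro len_letter_mult_le) auto
  then show ?case using Cons by auto
qed (simp add: len_one)

lemma foldr_append_letter:
  "\<lbrakk>set ts \<subseteq> L; t \<in> L\<rbrakk> \<Longrightarrow> foldr (\<otimes>) (ts @ [t]) \<one> = foldr (\<otimes>) ts \<one> \<otimes> t"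
  by (induction ts) (use len_foldr_le in \<open>auto simp: m_assoc\<close>)

lemma geodesic_word_exists:
  "g \<in> carrier G \<Longrightarrow> \<exists>ts. set ts \<subseteq> L \<and> length ts = len g \<and> g = foldr (\<otimes>) ts \<one>"
proof (induction g rule: descent_induct)
  case one
  then show ?case by (simp add: len_one)
next
  case (letter h t)
  then obtain ts where "set ts \<subseteq> L" "length ts = len h" "h = foldr (\<otimes>) ts \<one>" by blast
  then show ?case
    using letter foldr_append_letter[of ts t] by (intro exI[of _ "ts @ [t]"]) auto
qed

lemma word_metric_eq:
  assumes "L = S \<union> set_inv S" "g \<in> carrier G" "h \<in> carrier G"
  shows "word_metric G S g h = word_dist g h"
proof (cases "g = h")
  case True
  then show ?thesis using assms by (simp add: word_metric_def len_one)
next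
  case False
  obtain ts where "set ts \<subseteq> L" "length ts = len (inv g \<otimes> h)" "inv g \<otimes> h = foldr (\<otimes>) ts \<one>"
    using geodesic_word_exists[of "inv g \<otimes> h"] assms(2,3) by auto
  then have "(LEAST k. \<exists>s. length s = k \<and> set s \<subseteq> L \<and> inv g \<otimes> h = foldr (\<otimes>) s \<one>) = len (inv g \<otimes> h)"
    using len_foldr_le by (intro Least_equality) auto
  then show ?thesis using False assms(1) by (simp add: word_metric_def)
qed


theorem contractible_rips_group:
  assumes S: "L = S \<union> set_inv S" and r: "2 \<le> r"
  shows "contractible_space (realization (rips_group G S r))"
proof -
  define p where "p g = (SOME h. h \<in> carrier G \<and> len h < len g \<and> word_dist g h \<le> 2 \<and>
    (\<forall>u\<in>carrier G. len u \<le> len g \<longrightarrow> u \<noteq> g \<longrightarrow> word_dist u h \<le> word_dist u g))" for g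
  have p: "p g \<in> carrier G \<and> len (p g) < len g \<and> word_dist g (p g) \<le> 2 \<and>
      (\<forall>u\<in>carrier G. len u \<le> len g \<longrightarrow> u \<noteq> g \<longrightarrow> word_dist u (p g) \<le> word_dist u g)"
    if "g \<in> carrier G" "g \<noteq> \<one>" for g
    unfolding p_def by (rule someI_ex) (use dominating_element[OF that] in blast)
  let ?K = "rips_group G S r"
  have K: "\<sigma> \<in> ?K \<longleftrightarrow> \<sigma> \<noteq> {} \<and> finite \<sigma> \<and> \<sigma> \<subseteq> carrier G \<and> (\<forall>x\<in>\<sigma>. \<forall>y\<in>\<sigma>. word_dist x y \<le> r)" for \<sigma>
    unfolding rips_group_def rips_complex_iff using word_metric_eq[OF S] by (metis subsetD)
  have vertex: "{g} \<in> ?K \<longleftrightarrow> g \<in> carrier G" for g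
    using r by (auto simp: K len_one)
  interpret collapsing_complex ?K len p \<one>
  proof
    show "finite \<sigma> \<and> \<sigma> \<noteq> {}" if "\<sigma> \<in> ?K" for \<sigma>
      using that by (simp add: K)
    show "\<tau> \<in> ?K" if "\<sigma> \<in> ?K" "\<tau> \<subseteq> \<sigma>" "\<tau> \<noteq> {}" for \<sigma> \<tau>
      using that unfolding K by (meson finite_subset subset_iff)
    show "len (p g) < len g" if "{g} \<in> ?K" "len g > 0" for g
      using p[of g] that len_one by (cases "g = \<one>") (auto simp: vertex)
    show "len g = 0 \<longleftrightarrow> g = \<one>" if "{g} \<in> ?K" for g
      using that len_eq_0_iff by (simp add: vertex)
    show "{\<one>} \<in> ?K" by (simp add: vertex)
  next
    fix \<sigma> n assume \<sigma>: "\<sigma> \<in> ?K" and n: "\<And>g. g \<in> \<sigma> \<Longrightarrow> len g \<le> Suc n"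
    let ?T = "{g \<in> \<sigma>. len g = Suc n}"
    have c: "g \<in> carrier G" if "g \<in> \<sigma>" for g using \<sigma> that by (auto simp: K)
    have d: "word_dist g h \<le> r" if "g \<in> \<sigma>" "h \<in> \<sigma>" for g h using \<sigma> that by (auto simp: K)
    have pT: "p g \<in> carrier G" "len (p g) < Suc n" "word_dist g (p g) \<le> 2"
        "\<And>u. \<lbrakk>u \<in> carrier G; len u \<le> Suc n; u \<noteq> g\<rbrakk> \<Longrightarrow> word_dist u (p g) \<le> word_dist u g"
      if "g \<in> ?T" for g
    proof -
      have "g \<in> carrier G" "g \<noteq> \<one>" "len g = Suc n" using that c len_one by auto
      then show "p g \<in> carrier G" "len (p g) < Suc n" "word_dist g (p g) \<le> 2"
        "\<And>u. \<lbrakk>u \<in> carrier G; len u \<le> Suc n; u \<noteq> g\<rbrakk> \<Longrightarrow> word_dist u (p g) \<le> word_dist u g"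
        using p[of g] by simp_all
    qed
    have dp: "word_dist u (p g) \<le> r" if "u \<in> \<sigma>" "g \<in> ?T" for u g
    proof (cases "u = g")
      \<comment> \<open>A vertex and its own parent: the only place where the distance is bounded by
        2 rather than by an old distance.\<close>
      case True
      then show ?thesis using pT(3)[OF that(2)] r by simp
    next
      case False
      then have "word_dist u (p g) \<le> word_dist u g"
        using pT(4)[OF that(2)] n c that(1) by blast
      then show ?thesis using d[of u g] that by simp
    qed
    have pd: "word_dist (p g) u \<le> r" if "u \<in> \<sigma>" "g \<in> ?T" for u g
      using dp[OF that] word_dist_commute[of "p g" u] pT(1)[OF that(2)] c that(1) by simp
    have pp: "word_dist (p g) (p h) \<le> r" if "g \<in> ?T" "h \<in> ?T" for g h
    proof -
      \<comment> \<open>The two ends are moved one at a time: \<open>p g\<close> lies below the top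
        level, so it is an admissible \<open>u\<close> for \<open>h\<close>, and its distance to
        \<open>h\<close> is already bounded.\<close>
      have "p g \<noteq> h" "len (p g) \<le> Suc n" using pT(2)[OF that(1)] that(2) by auto
      then have "word_dist (p g) (p h) \<le> word_dist (p g) h"
        using pT(4)[OF that(2)] pT(1)[OF that(1)] by blast
      then show ?thesis using pd[of h g] that by simp
    qed
    show "\<sigma> \<union> p ` ?T \<in> ?K"
      unfolding K
    proof (intro conjI ballI)
      show "finite (\<sigma> \<union> p ` ?T)" "\<sigma> \<union> p ` ?T \<noteq> {}" using \<sigma> by (auto simp: K)
      show "\<sigma> \<union> p ` ?T \<subseteq> carrier G" using c pT(1) by blast
      fix x y assume "x \<in> \<sigma> \<union> p ` ?T" "y \<in> \<sigma> \<union> p ` ?T"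
      then show "word_dist x y \<le> r" using d dp pd pp by blast
    qed
  qed
  show ?thesis by (rule contractible_realization)
qed

end

section \<open>Pilings\<close>

text \<open>
  Each vertex carries a stack. A letter pushes its sign on its own stack and a blank on the stacks of
  the vertices that it does not commute with, unless its inverse is on top of its own stack,
  which is then removed together with the corresponding blanks. The second component counts the
  letters stored in the piling.
\<close>

type_synonym 'v piling = "('v \<Rightarrow> bool option list) \<times> nat"

definition opposite :: "'v \<times> bool \<Rightarrow> 'v \<times> bool" where
  "opposite a = (fst a, \<not> snd a)"

text \<open>With \<open>take 1\<close> an empty stack gives False, whereas \<open>hd\<close> would
  be unspecified there.\<close>

definition on_top :: "'v piling \<Rightarrow> 'v \<times> bool \<Rightarrow> bool" where
  "on_top s a \<longleftrightarrow> take 1 (fst s (fst a)) = [Some (snd a)]"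

definition push_letter :: "('v \<times> 'v) set \<Rightarrow> 'v \<times> bool \<Rightarrow> 'v piling \<Rightarrow> 'v piling" where
  "push_letter E a s =
    (\<lambda>z. if z = fst a then Some (snd a) # fst s z
         else if (fst a, z) \<in> E then fst s z else None # fst s z, Suc (snd s))"

text \<open>Applied by \<open>act\<close> when the opposite of \<open>a\<close> is on top. In a
  loop-free graph the own stack of \<open>a\<close> falls under \<open>tl\<close> together with
  those carrying its blanks.\<close>

definition pop_letter :: "('v \<times> 'v) set \<Rightarrow> 'v \<times> bool \<Rightarrow> 'v piling \<Rightarrow> 'v piling" where
  "pop_letter E a s = (\<lambda>z. if (fst a, z) \<in> E then fst s z else tl (fst s z), snd s - 1)"

definition act :: "('v \<times> 'v) set \<Rightarrow> 'v piling \<Rightarrow> 'v \<times> bool \<Rightarrow> 'v piling" where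
  "act E s a = (if on_top s (opposite a) then pop_letter E a s else push_letter E a s)"

definition piling :: "('v \<times> 'v) set \<Rightarrow> 'v gword \<Rightarrow> 'v piling" where
  "piling E w = foldl (act E) (\<lambda>_. [], 0) w"

text \<open>The piling of such a word arises by pushes alone, so what lies on top can be traced back
  to a letter of the word.\<close>

inductive reduced :: "('v \<times> 'v) set \<Rightarrow> 'v gword \<Rightarrow> bool" for E where
  reduced_Nil: "reduced E []"
| reduced_snoc: "\<lbrakk>reduced E w; \<not> on_top (piling E w) (opposite a)\<rbrakk> \<Longrightarrow> reduced E (w @ [a])"

lemma opposite_simps [simp]:
  "opposite (opposite a) = a" "fst (opposite a) = fst a" "opposite a \<noteq> a"
  by (auto simp: opposite_def prod_eq_iff)

lemma opposite_inject: "opposite a = opposite b \<longleftrightarrow> a = b"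
  by (metis opposite_simps(1))

lemma piling_snoc: "piling E (w @ [a]) = act E (piling E w) a"
  by (simp add: piling_def)

lemma piling_append: "piling E (u @ v) = foldl (act E) (piling E u) v"
  by (simp add: piling_def)

lemma on_top_unique: "\<lbrakk>on_top s a; on_top s b; fst a = fst b\<rbrakk> \<Longrightarrow> a = b"
  by (auto simp: on_top_def prod_eq_iff)

lemma piling_reduced_snoc:
  "\<not> on_top (piling E w) (opposite a) \<Longrightarrow> piling E (w @ [a]) = push_letter E a (piling E w)"
  by (simp add: piling_snoc act_def)

locale raag_graph =
  fixes \<Gamma> :: "'v pair_pre_digraph"
  assumes graph: "pair_graph \<Gamma>"
begin

abbreviation "X \<equiv> pverts \<Gamma>"
abbreviation "E \<equiv> parcs \<Gamma>"
abbreviation "wcong \<equiv> pres_cong X (raag_relations \<Gamma>)"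
abbreviation "cls \<equiv> pres_class X (raag_relations \<Gamma>)"
abbreviation "A \<equiv> presented_group X (raag_relations \<Gamma>)"

sublocale A: group A
  by (rule group_presented_group)

lemma edge_sym: "(x, y) \<in> E \<Longrightarrow> (y, x) \<in> E"
proof -
  interpret pair_graph \<Gamma> by (rule graph)
  show "(x, y) \<in> E \<Longrightarrow> (y, x) \<in> E" by (rule arcs_symmetric)
qed

lemma no_loop: "(x, x) \<notin> E"
proof -
  interpret pair_graph \<Gamma> by (rule graph)
  show ?thesis using no_loops' by blast
qed

lemma edge_vertices: "(x, y) \<in> E \<Longrightarrow> x \<in> X \<and> y \<in> X"
proof -
  interpret pair_graph \<Gamma> by (rule graph)
  show "(x, y) \<in> E \<Longrightarrow> x \<in> X \<and> y \<in> X" using in_arcsD1 in_arcsD2 by blast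
qed

lemma gwords_Cons: "a # w \<in> gwords X \<longleftrightarrow> fst a \<in> X \<and> w \<in> gwords X"
  by (cases a) (auto simp: gwords_def)

lemma cong_cancel: "fst a \<in> X \<Longrightarrow> wcong [a, opposite a] []"
  using pres_cong.cancel[of "fst a" X "raag_relations \<Gamma>" "snd a"] by (simp add: opposite_def)

lemma cong_append_right: "\<lbrakk>wcong u v; w \<in> gwords X\<rbrakk> \<Longrightarrow> wcong (u @ w) (v @ w)"
  by (intro pres_cong.append pres_cong.refl)

lemma cong_append_left: "\<lbrakk>wcong u v; w \<in> gwords X\<rbrakk> \<Longrightarrow> wcong (w @ u) (w @ v)"
  by (intro pres_cong.append pres_cong.refl)

lemma cls_closed: "w \<in> gwords X \<Longrightarrow> cls w \<in> carrier A"
  by (simp add: presented_group_def)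

lemma carrier_cases: "g \<in> carrier A \<Longrightarrow> \<exists>w\<in>gwords X. g = cls w"
  by (auto simp: presented_group_def)

lemma one_eq: "\<one>\<^bsub>A\<^esub> = cls []"
  by (simp add: presented_group_def)

lemma inv_letter: "fst a \<in> X \<Longrightarrow> inv\<^bsub>A\<^esub> (cls [a]) = cls [opposite a]"
proof (rule A.inv_equality)
  assume a: "fst a \<in> X"
  have "cls ([opposite a] @ [a]) = cls []"
    using cong_cancel[of "opposite a"] a by (subst pres_class_eq_iff) (auto simp: gwords_Cons)
  then show "cls [opposite a] \<otimes>\<^bsub>A\<^esub> cls [a] = \<one>\<^bsub>A\<^esub>"
    using a by (simp add: presented_group_mult gwords_Cons one_eq)
qed (simp_all add: cls_closed gwords_Cons)

text \<open>The relations concern positive letters only; the other signs follow from the fact that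
  an element commuting with \<open>g\<close> also commutes with its inverse.\<close>

lemma letters_commute:
  assumes "(fst a, fst b) \<in> E"
  shows "cls [a] \<otimes>\<^bsub>A\<^esub> cls [b] = cls [b] \<otimes>\<^bsub>A\<^esub> cls [a]"
proof -
  obtain x s y t where ab: "a = (x, s)" "b = (y, t)" by (metis surj_pair)
  have X: "x \<in> X" "y \<in> X" using edge_vertices assms ab by auto
  have inv_commute: "inv\<^bsub>A\<^esub> g \<otimes>\<^bsub>A\<^esub> h = h \<otimes>\<^bsub>A\<^esub> inv\<^bsub>A\<^esub> g"
    if "g \<otimes>\<^bsub>A\<^esub> h = h \<otimes>\<^bsub>A\<^esub> g" "g \<in> carrier A" "h \<in> carrier A" for g h
    using that by (metis A.inv_closed A.inv_solve_left A.inv_solve_right A.m_assoc A.m_closed)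
  have "([(x, True), (y, True)], [(y, True), (x, True)]) \<in> raag_relations \<Gamma>"
    using assms ab by (auto simp: raag_relations_def)
  then have "wcong ([(x, True)] @ [(y, True)]) ([(y, True)] @ [(x, True)])"
    using X by (auto intro: pres_cong.rel simp: gwords_def)
  then have "cls ([(x, True)] @ [(y, True)]) = cls ([(y, True)] @ [(x, True)])"
    using X by (subst pres_class_eq_iff) (auto simp: gwords_def)
  then have pp: "cls [(x, True)] \<otimes>\<^bsub>A\<^esub> cls [(y, True)] = cls [(y, True)] \<otimes>\<^bsub>A\<^esub> cls [(x, True)]"
    using X by (simp add: presented_group_mult gwords_def)
  have c: "cls [(x, u)] \<in> carrier A" "cls [(y, u)] \<in> carrier A" for u
    using X by (simp_all add: cls_closed gwords_Cons)
  have i: "inv\<^bsub>A\<^esub> (cls [(x, True)]) = cls [(x, False)]" "inv\<^bsub>A\<^esub> (cls [(y, True)]) = cls [(y, False)]"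
    using X inv_letter[of "(x, True)"] inv_letter[of "(y, True)"] by (simp_all add: opposite_def)
  have mp: "cls [(x, False)] \<otimes>\<^bsub>A\<^esub> cls [(y, True)] = cls [(y, True)] \<otimes>\<^bsub>A\<^esub> cls [(x, False)]"
    using inv_commute[OF pp] c i by simp
  have pm: "cls [(y, False)] \<otimes>\<^bsub>A\<^esub> cls [(x, True)] = cls [(x, True)] \<otimes>\<^bsub>A\<^esub> cls [(y, False)]"
    using inv_commute[OF pp[symmetric]] c i by simp
  have mm: "cls [(y, False)] \<otimes>\<^bsub>A\<^esub> cls [(x, False)] = cls [(x, False)] \<otimes>\<^bsub>A\<^esub> cls [(y, False)]"
    using inv_commute[OF mp[symmetric]] c i by simp
  show ?thesis
    unfolding ab by (cases s; cases t) (simp_all add: pp mp pm mm)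
qed

lemma cong_swap:
  assumes "(fst a, fst b) \<in> E"
  shows "wcong [a, b] [b, a]"
proof -
  have "[a] \<in> gwords X" "[b] \<in> gwords X" "[a, b] \<in> gwords X"
    using edge_vertices[OF assms] by (cases a; cases b; auto simp: gwords_def)+
  then show ?thesis
    using letters_commute[OF assms] by (simp add: presented_group_mult pres_class_eq_iff)
qed

section \<open>Moves of pilings and invariance under the congruence\<close>

lemma pop_push: "fst b = fst a \<Longrightarrow> pop_letter E b (push_letter E a s) = s"
  using no_loop by (auto simp: pop_letter_def push_letter_def prod_eq_iff)

lemma push_push:
  "(fst a, fst b) \<in> E \<Longrightarrow> push_letter E a (push_letter E b s) = push_letter E b (push_letter E a s)"
  using no_loop edge_sym by (auto simp: push_letter_def prod_eq_iff fun_eq_iff)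

lemma on_top_push_same: "fst b = fst a \<Longrightarrow> on_top (push_letter E a s) b \<longleftrightarrow> b = a"
  by (auto simp: on_top_def push_letter_def prod_eq_iff)

lemma on_top_push_edge: "(fst a, fst b) \<in> E \<Longrightarrow> on_top (push_letter E a s) b \<longleftrightarrow> on_top s b"
  using no_loop by (auto simp: on_top_def push_letter_def)

lemma on_top_pop_edge: "(fst a, fst b) \<in> E \<Longrightarrow> on_top (pop_letter E a s) b \<longleftrightarrow> on_top s b"
  by (simp add: on_top_def pop_letter_def)

lemma on_top_push_non_edge:
  "\<lbrakk>fst b \<noteq> fst a; (fst a, fst b) \<notin> E\<rbrakk> \<Longrightarrow> \<not> on_top (push_letter E a s) b"
  by (simp add: on_top_def push_letter_def)

text \<open>A letter on top can be moved to the end of the word. A last letter \<open>c\<close> at a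
  non-adjacent other vertex would have covered it with a blank; at an adjacent vertex,
  \<open>c\<close> commutes with \<open>a\<close> and left its stack alone, so the two swap.\<close>

lemma reduced_on_top_last:
  assumes "reduced E w" "w \<in> gwords X" "on_top (piling E w) a"
  shows "\<exists>v. v \<in> gwords X \<and> fst a \<in> X \<and> reduced E v \<and>
    \<not> on_top (piling E v) (opposite a) \<and> wcong w (v @ [a]) \<and> piling E w = push_letter E a (piling E v)"
  using assms
proof (induction rule: reduced.induct)
  case reduced_Nil
  then show ?case by (simp add: piling_def on_top_def)
next
  case (reduced_snoc w c)
  have w: "w \<in> gwords X" "fst c \<in> X"
    using reduced_snoc.prems(1) by (simp_all add: gwords_Cons)
  have P: "piling E (w @ [c]) = push_letter E c (piling E w)"
    using reduced_snoc.hyps(2) by (rule piling_reduced_snoc)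
  consider "fst a = fst c" | "fst a \<noteq> fst c" "(fst c, fst a) \<in> E" | "fst a \<noteq> fst c" "(fst c, fst a) \<notin> E"
    by blast
  then show ?case
  proof cases
    case 1
    then have "a = c" using reduced_snoc.prems(2) P by (simp add: on_top_push_same)
    then show ?thesis
      using reduced_snoc.hyps P w reduced_snoc.prems(1)
      by (intro exI[of _ w]) (auto intro: reduced.reduced_snoc pres_cong.refl)
  next
    case 2
    then have "on_top (piling E w) a"
      using reduced_snoc.prems(2) P by (simp add: on_top_push_edge)
    then obtain v where v: "v \<in> gwords X" "fst a \<in> X" "reduced E v"
        "\<not> on_top (piling E v) (opposite a)" "wcong w (v @ [a])" "piling E w = push_letter E a (piling E v)"
      using reduced_snoc.IH w by blast
    have e: "(fst a, fst c) \<in> E" using 2 edge_sym by blast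
    have nc: "\<not> on_top (piling E v) (opposite c)"
      using reduced_snoc.hyps(2) v(6) e on_top_push_edge[of a "opposite c"] by simp
    let ?v = "v @ [c]"
    have Pv: "piling E ?v = push_letter E c (piling E v)"
      using nc by (rule piling_reduced_snoc)
    have na: "\<not> on_top (piling E ?v) (opposite a)"
      using v(4) 2 on_top_push_edge[of c "opposite a"] by (simp add: Pv)
    have "wcong (w @ [c]) ((v @ [a]) @ [c])"
      using v(5) w by (intro cong_append_right) (simp_all add: gwords_Cons)
    moreover have "wcong (v @ [a, c]) (v @ [c, a])"
      using v(1) cong_swap[OF e] by (intro cong_append_left)
    ultimately have "wcong (w @ [c]) (?v @ [a])"
      by (auto intro: pres_cong.trans)
    moreover have "piling E (w @ [c]) = push_letter E a (piling E ?v)"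
      using P v(6) Pv push_push[OF e] by simp
    moreover have "reduced E ?v"
      using v(3) nc by (rule reduced.reduced_snoc)
    ultimately show ?thesis
      using v w na by (intro exI[of _ ?v]) (auto simp: gwords_Cons)
  next
    case 3
    then show ?thesis
      using reduced_snoc.prems(2) P on_top_push_non_edge by simp
  qed
qed

text \<open>If the next letter cancels, its opposite is first moved to the end of the reduced word
  and dropped there; popping undoes exactly the corresponding push.\<close>

lemma reduced_form:
  "w \<in> gwords X \<Longrightarrow> \<exists>v\<in>gwords X. reduced E v \<and> wcong w v \<and> piling E v = piling E w"
proof (induction w rule: rev_induct)
  case Nil
  then show ?case by (intro bexI[of _ "[]"]) (auto intro: reduced.reduced_Nil pres_cong.refl)
next
  case (snoc a w)
  have a: "fst a \<in> X" "[a] \<in> gwords X" using snoc.prems by (simp_all add: gwords_Cons)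
  obtain v where v: "v \<in> gwords X" "reduced E v" "wcong w v" "piling E v = piling E w"
    using snoc by auto
  have wv: "wcong (w @ [a]) (v @ [a])"
    using v(3) a by (intro cong_append_right)
  show ?case
  proof (cases "on_top (piling E v) (opposite a)")
    case True
    then obtain u where u: "u \<in> gwords X" "reduced E u" "wcong v (u @ [opposite a])"
        "piling E v = push_letter E (opposite a) (piling E u)"
      using reduced_on_top_last v by blast
    have "wcong (v @ [a]) ((u @ [opposite a]) @ [a])"
      using u(3) a by (intro cong_append_right)
    moreover have "wcong (u @ [opposite a, a]) (u @ [])"
      using cong_cancel[of "opposite a"] a u(1) by (intro cong_append_left) simp_all
    ultimately have "wcong (w @ [a]) u"
      using wv by (auto intro: pres_cong.trans)
    moreover have "pop_letter E a (piling E v) = piling E u"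
      unfolding u(4) by (rule pop_push) simp
    then have "piling E (w @ [a]) = piling E u"
      using v(4) True by (simp add: piling_snoc act_def)
    ultimately show ?thesis using u by auto
  next
    case False
    then show ?thesis
      using v a wv by (intro bexI[of _ "v @ [a]"]) (auto simp: piling_snoc intro: reduced.reduced_snoc)
  qed
qed

text \<open>On arbitrary stacks a pop may destroy entries that the following push does not restore.
  A reduced word with the same piling shows that what is popped had been pushed.\<close>

lemma piling_cancel:
  assumes "w \<in> gwords X" "fst a \<in> X"
  shows "piling E (w @ [a, opposite a]) = piling E w"
proof -
  obtain v where v: "v \<in> gwords X" "reduced E v" "piling E v = piling E w"
    using reduced_form assms by blast
  have "act E (act E (piling E v) a) (opposite a) = piling E v"
  proof (cases "on_top (piling E v) (opposite a)")
    case True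
    then obtain u where "piling E v = push_letter E (opposite a) (piling E u)"
        "\<not> on_top (piling E u) a"
      using reduced_on_top_last[OF v(2,1) True] by auto
    then show ?thesis using True by (simp add: act_def pop_push)
  next
    case False
    then show ?thesis by (simp add: act_def pop_push on_top_push_same)
  qed
  then show ?thesis using v(3) by (simp add: piling_append)
qed

lemma pop_pop: "pop_letter E a (pop_letter E b s) = pop_letter E b (pop_letter E a s)"
  by (auto simp: pop_letter_def)

lemma act_swap:
  assumes "(fst c, fst d) \<in> E" "\<not> on_top (push_letter E (opposite c) s) (opposite d)"
  shows "act E (act E (push_letter E (opposite c) s) c) d = act E (act E (push_letter E (opposite c) s) d) c"
proof -
  let ?s = "push_letter E (opposite c) s"
  have e: "(fst d, fst (opposite c)) \<in> E" using assms(1) edge_sym by simp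
  have "\<not> on_top s (opposite d)"
    using assms on_top_push_edge[of "opposite c" "opposite d"] by simp
  then have "act E (act E ?s c) d = push_letter E d s"
    by (simp add: act_def pop_push on_top_push_same)
  moreover have "act E ?s d = push_letter E (opposite c) (push_letter E d s)"
    using assms(2) push_push[OF e] by (simp add: act_def)
  then have "act E (act E ?s d) c = push_letter E d s"
    by (simp add: act_def pop_push on_top_push_same)
  ultimately show ?thesis by simp
qed

text \<open>Two pushes or two pops at adjacent vertices commute as they stand. If just one letter
  cancels, \<open>reduced_on_top_last\<close> displays the piling as a push of its opposite, and
  \<open>act_swap\<close> applies.\<close>

lemma piling_swap:
  assumes "w \<in> gwords X" "(fst a, fst b) \<in> E"
  shows "piling E (w @ [a, b]) = piling E (w @ [b, a])"
proof -
  obtain v where v: "v \<in> gwords X" "reduced E v" "piling E v = piling E w"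
    using reduced_form assms by blast
  have e: "(fst b, fst a) \<in> E" using assms edge_sym by blast
  have pop_push_swap: "act E (act E (piling E v) c) d = act E (act E (piling E v) d) c"
    if top: "on_top (piling E v) (opposite c)" and "\<not> on_top (piling E v) (opposite d)"
      and "(fst c, fst d) \<in> E" for c d
  proof -
    obtain u where "piling E v = push_letter E (opposite c) (piling E u)"
      using reduced_on_top_last[OF v(2,1) top] by blast
    then show ?thesis using act_swap that by simp
  qed
  have "act E (act E (piling E v) a) b = act E (act E (piling E v) b) a"
  proof (cases "on_top (piling E v) (opposite a)"; cases "on_top (piling E v) (opposite b)")
    assume a: "on_top (piling E v) (opposite a)" and b: "on_top (piling E v) (opposite b)"
    then show ?thesis
      using pop_pop[of b a "piling E v"] assms(2) e by (simp add: act_def on_top_pop_edge)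
  next
    assume a: "\<not> on_top (piling E v) (opposite a)" and b: "\<not> on_top (piling E v) (opposite b)"
    then show ?thesis
      using push_push[OF assms(2)] assms(2) e by (simp add: act_def on_top_push_edge)
  qed (use pop_push_swap assms(2) e in \<open>simp_all\<close>)
  then show ?thesis using v(3) by (simp add: piling_append)
qed

text \<open>The prefix \<open>w\<close> carries the induction through \<open>append\<close>, and it
  restricts the claim to stacks that come from words, where cancellation is reversible.\<close>

lemma piling_cong:
  assumes "wcong u v" "w \<in> gwords X"
  shows "piling E (w @ u) = piling E (w @ v)"
  using assms
proof (induction arbitrary: w)
  case (append u u' v v')
  have "u' \<in> gwords X" using pres_cong_words append.hyps(1) by blast
  have "piling E ((w @ u) @ v) = piling E ((w @ u') @ v)"
    using append.IH(1)[OF append.prems] by (simp add: piling_def)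
  also have "\<dots> = piling E ((w @ u') @ v')"
    using append.IH(2)[of "w @ u'"] append.prems \<open>u' \<in> gwords X\<close> by simp
  finally show ?case by simp
next
  case (cancel x b)
  then show ?case using piling_cancel[of w "(x, b)"] by (simp add: opposite_def)
next
  case (rel u v)
  then show ?case by (auto simp: raag_relations_def intro: piling_swap)
qed auto

section \<open>Length of group elements and its descents\<close>

definition len :: "'v gword set \<Rightarrow> nat" where
  "len g = snd (piling E (SOME w. w \<in> g))"

lemma len_cls: "w \<in> gwords X \<Longrightarrow> len (cls w) = snd (piling E w)"
proof -
  assume w: "w \<in> gwords X"
  then have "w \<in> cls w" by (simp add: pres_class_def pres_cong.refl)
  then have "(SOME v. v \<in> cls w) \<in> cls w" by (rule someI)
  then have "wcong w (SOME v. v \<in> cls w)" by (simp add: pres_class_def)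
  then show ?thesis using piling_cong[of w _ "[]"] by (simp add: len_def)
qed

lemma reduced_representative:
  assumes "g \<in> carrier A"
  obtains w where "w \<in> gwords X" "reduced E w" "g = cls w"
proof -
  obtain v where "v \<in> gwords X" "g = cls v" using carrier_cases assms by blast
  moreover obtain w where "w \<in> gwords X" "reduced E w" "wcong v w"
    using reduced_form \<open>v \<in> gwords X\<close> by blast
  ultimately show ?thesis using that pres_class_eq_iff by blast
qed

definition letters :: "'v gword set set" where
  "letters = (\<lambda>a. cls [a]) ` (X \<times> UNIV)"

lemma letters_cases: "t \<in> letters \<Longrightarrow> \<exists>a. fst a \<in> X \<and> t = cls [a]"
  by (auto simp: letters_def)

text \<open>Positivity is recorded separately because the subtraction in the first claim is
  truncated at 0.\<close>

lemma len_mult_letter: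
  assumes "w \<in> gwords X" "reduced E w" "fst a \<in> X"
  shows "len (cls w \<otimes>\<^bsub>A\<^esub> cls [a]) = (if on_top (piling E w) (opposite a)
    then len (cls w) - 1 else Suc (len (cls w)))"
    and "on_top (piling E w) (opposite a) \<Longrightarrow> len (cls w) > 0"
proof -
  have "len (cls w \<otimes>\<^bsub>A\<^esub> cls [a]) = snd (act E (piling E w) a)"
    using assms by (simp add: presented_group_mult gwords_Cons len_cls piling_snoc)
  then show "len (cls w \<otimes>\<^bsub>A\<^esub> cls [a]) = (if on_top (piling E w) (opposite a)
    then len (cls w) - 1 else Suc (len (cls w)))"
    using assms by (simp add: act_def push_letter_def pop_letter_def len_cls)
  show "len (cls w) > 0" if "on_top (piling E w) (opposite a)"
    using reduced_on_top_last[OF assms(2,1) that] assms by (auto simp: len_cls push_letter_def)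
qed

lemma descent_iff:
  assumes "w \<in> gwords X" "reduced E w" "fst a \<in> X"
  shows "len (cls w \<otimes>\<^bsub>A\<^esub> cls [a]) < len (cls w) \<longleftrightarrow> on_top (piling E w) (opposite a)"
  using len_mult_letter[OF assms] by (auto split: if_splits)

text \<open>The piling is a push of \<open>a\<close>, which puts a blank on the stack of every other
  vertex not adjacent to that of \<open>a\<close>; and one stack cannot show two signs.\<close>

lemma on_top_edge:
  assumes "w \<in> gwords X" "reduced E w" "on_top (piling E w) a" "on_top (piling E w) b" "a \<noteq> b"
  shows "(fst a, fst b) \<in> E"
proof -
  have "piling E w = push_letter E a s \<Longrightarrow> (fst a, fst b) \<in> E" for s
    using assms(3-5) on_top_unique on_top_push_non_edge by metis
  then show ?thesis using reduced_on_top_last[OF assms(2,1,3)] by blast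
qed

lemma descents_edge:
  assumes "g \<in> carrier A" "fst a \<in> X" "fst b \<in> X" "cls [a] \<noteq> cls [b]"
    "len (g \<otimes>\<^bsub>A\<^esub> cls [a]) < len g" "len (g \<otimes>\<^bsub>A\<^esub> cls [b]) < len g"
  shows "(fst a, fst b) \<in> E"
proof -
  obtain w where w: "w \<in> gwords X" "reduced E w" "g = cls w"
    using reduced_representative assms(1) by blast
  have "opposite a \<noteq> opposite b" using assms(4) by (auto simp: opposite_inject)
  then show ?thesis
    using on_top_edge[OF w(1,2), of "opposite a" "opposite b"] descent_iff[OF w(1,2)] assms w(3) by simp
qed

lemma diamond_group_raag:
  assumes "triangle_free \<Gamma>"
  shows "diamond_group A letters len"
proof unfold_locales
  show "letters \<subseteq> carrier A"
    by (auto simp: letters_def intro!: cls_closed simp: gwords_Cons)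
  show "inv\<^bsub>A\<^esub> t \<in> letters" if "t \<in> letters" for t
    using that by (auto simp: letters_def inv_letter opposite_def)
  show "len \<one>\<^bsub>A\<^esub> = 0"
    by (simp add: one_eq len_cls) (simp add: piling_def)
next
  fix g t assume g: "g \<in> carrier A" and t: "t \<in> letters"
  obtain w where w: "w \<in> gwords X" "reduced E w" "g = cls w"
    using reduced_representative g by blast
  obtain a where a: "fst a \<in> X" "t = cls [a]"
    using letters_cases t by blast
  show "len (g \<otimes>\<^bsub>A\<^esub> t) = Suc (len g) \<or> len g = Suc (len (g \<otimes>\<^bsub>A\<^esub> t))"
    using len_mult_letter[OF w(1,2) a(1)] w(3) a(2) by auto
next
  fix g assume g: "g \<in> carrier A" "g \<noteq> \<one>\<^bsub>A\<^esub>"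
  obtain w where w: "w \<in> gwords X" "reduced E w" "g = cls w"
    using reduced_representative g by blast
  have "w \<noteq> []" using g w by (auto simp: one_eq)
  with w(2) obtain v a where v: "w = v @ [a]" "\<not> on_top (piling E v) (opposite a)"
    by (auto elim: reduced.cases)
  have a: "fst a \<in> X" using w(1) v(1) by (simp add: gwords_Cons)
  have "on_top (piling E w) (opposite (opposite a))"
    using v by (simp add: piling_reduced_snoc on_top_push_same)
  then have "len (g \<otimes>\<^bsub>A\<^esub> cls [opposite a]) < len g"
    using descent_iff[OF w(1,2), of "opposite a"] a w(3) by simp
  moreover have "cls [opposite a] \<in> letters"
    using a by (auto simp: letters_def opposite_def)
  ultimately show "\<exists>t\<in>letters. len (g \<otimes>\<^bsub>A\<^esub> t) < len g" by blast
next
  fix g s t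
  assume g: "g \<in> carrier A" and st: "s \<in> letters" "t \<in> letters" "s \<noteq> t"
    and d: "len (g \<otimes>\<^bsub>A\<^esub> s) < len g" "len (g \<otimes>\<^bsub>A\<^esub> t) < len g"
  obtain w where w: "w \<in> gwords X" "reduced E w" "g = cls w"
    using reduced_representative g by blast
  obtain a b where ab: "fst a \<in> X" "s = cls [a]" "fst b \<in> X" "t = cls [b]"
    using letters_cases st by metis
  have e: "(fst a, fst b) \<in> E"
    using descents_edge g ab st d by blast
  have top: "on_top (piling E w) (opposite a)" "on_top (piling E w) (opposite b)"
    using descent_iff[OF w(1,2)] ab w(3) d by auto
  have wa: "w @ [a] \<in> gwords X" using w ab by (simp add: gwords_Cons)
  obtain v where v: "v \<in> gwords X" "reduced E v" "wcong (w @ [a]) v" "piling E v = piling E (w @ [a])"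
    using reduced_form[OF wa] by blast
  \<comment> \<open>Popping for \<open>a\<close> leaves the stack of the adjacent vertex of
    \<open>b\<close> untouched; the reduced word \<open>v\<close> is there because
    \<open>descent_iff\<close> needs one.\<close>
  have "on_top (piling E v) (opposite b)"
    using v(4) top e on_top_pop_edge[of a "opposite b"] by (simp add: piling_snoc act_def)
  then have "len (cls v \<otimes>\<^bsub>A\<^esub> t) < len (cls v)"
    using descent_iff[OF v(1,2)] ab by simp
  moreover have "cls (w @ [a]) = cls v"
    using v(3) wa by (simp only: pres_class_eq_iff)
  then have "cls v = g \<otimes>\<^bsub>A\<^esub> s"
    using w ab by (simp add: presented_group_mult gwords_Cons)
  ultimately show "s \<otimes>\<^bsub>A\<^esub> t = t \<otimes>\<^bsub>A\<^esub> s \<and> len (g \<otimes>\<^bsub>A\<^esub> s \<otimes>\<^bsub>A\<^esub> t) < len (g \<otimes>\<^bsub>A\<^esub> s)"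
    using letters_commute[OF e] ab by simp
next
  fix g s t u
  assume g: "g \<in> carrier A" and l: "s \<in> letters" "t \<in> letters" "u \<in> letters"
    and n: "s \<noteq> t" "s \<noteq> u" "t \<noteq> u"
    and d: "len (g \<otimes>\<^bsub>A\<^esub> s) < len g" "len (g \<otimes>\<^bsub>A\<^esub> t) < len g"
  show "\<not> len (g \<otimes>\<^bsub>A\<^esub> u) < len g"
  proof
    assume d': "len (g \<otimes>\<^bsub>A\<^esub> u) < len g"
    obtain a b c where abc: "fst a \<in> X" "s = cls [a]" "fst b \<in> X" "t = cls [b]" "fst c \<in> X" "u = cls [c]"
      using letters_cases l by metis
    \<comment> \<open>Three distinct descents would span a triangle.\<close>
    have "(fst a, fst b) \<in> E" "(fst b, fst c) \<in> E" "(fst a, fst c) \<in> E"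
      using descents_edge g abc n d d' by blast+
    then show False using assms unfolding triangle_free_def by blast
  qed
qed

lemma letters_eq: "letters = raag_generators \<Gamma> \<union> set_inv\<^bsub>A\<^esub> (raag_generators \<Gamma>)"
proof -
  have "X \<times> UNIV = (\<lambda>x. (x, True)) ` X \<union> (\<lambda>x. (x, False)) ` X"
    by auto
  then have "letters = (\<lambda>x. cls [(x, True)]) ` X \<union> (\<lambda>x. cls [(x, False)]) ` X"
    by (simp add: letters_def image_Un image_image)
  moreover have "set_inv\<^bsub>A\<^esub> (raag_generators \<Gamma>) = (\<lambda>x. cls [(x, False)]) ` X"
    using inv_letter by (auto simp: SET_INV_def raag_generators_def opposite_def)
  ultimately show ?thesis by (simp add: raag_generators_def)
qed

end

theorem theorem1p5:
  fixes \<Gamma> :: "'v pair_pre_digraph"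
  assumes "pair_graph \<Gamma>"
    and "triangle_free \<Gamma>"
  shows "type_R (raag \<Gamma>) (raag_generators \<Gamma>) \<and>
    (\<forall>r\<ge>2. contractible_space (realization (rips_group (raag \<Gamma>) (raag_generators \<Gamma>) r)))"
proof -
  interpret raag_graph \<Gamma> using assms(1) by (rule raag_graph.intro)
  interpret diamond_group A letters len
    using assms(2) by (rule diamond_group_raag)
  have "contractible_space (realization (rips_group (raag \<Gamma>) (raag_generators \<Gamma>) r))" if "r \<ge> 2" for r
    unfolding raag_def using letters_eq that by (rule contractible_rips_group)
  moreover from this have "type_R (raag \<Gamma>) (raag_generators \<Gamma>)"
    using marked_group_raag[OF assms(1)] unfolding type_R_def by (intro conjI exI[of _ 2]) auto
  ultimately show ?thesis by blast
qed

end
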